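(* Let $c\in(0,1]$, $\eta\ge0$, and let $F$ be a continuous distribution with support $[0,1]$ and mean $\mu$. Define $$\bar c=\mathbb{E}_{v\sim F}\big[v\mid v\ge F^{-1}(e^{-\eta})\big]\ \text{ if }\eta>0,\qquad \bar c=1\ \text{ if }\eta=0.$$ The buyer's maximal robust surplus is strictly positive if and only if $c<\bar c$. For any $c<\bar c$, there is a buyer-optimal $G$ such that, writing $\alpha^*=\mathbb{P}_G[s>c]$ for the probability that $s>c$ and $r^*$ for the seller's profit conditional on $s>c$ (i.e. $(p^*(H)-c)\,\mathbb{P}_G[s\ge p^*(H)\mid s>c]=r^*$ for every admissible $H$), the pair $(\alpha^*,r^* )$ attains the maximum in $$\max_{(\alpha,r):\ \Gamma_\eta(\alpha,r)\ge\max\{\mu-c,\ \alpha r\}}\big[\Gamma_\eta(\alpha,r)-\alpha r\big],\qquad \alpha\in[0,1],\ r\ge0,$$ and $G$ consists of a single no-trade signal (at most $c$) having probability $1-\alpha^*$ and otherwise, conditional on $s>c$, a signal supported on $[c+r^*,c+B^*]$ for some $B^*\ge r^*$, with $$\mathbb{P}_G[s\ge p\mid s>c]=I_{\eta^*(\alpha^* )}\!\left(\frac{r^*}{p-c}\right)\qquad\text{for all } c+r^*<p\le c+B^*.$$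
   Context: Model. A seller with production cost $c$ sells one unit to a buyer with value $v\sim F$. The buyer chooses an information structure; signals are normalized to equal the induced posterior expectation $s$ of $v$, and $G$ denotes the distribution (and CDF) of $s$. A distribution $G$ on $[0,1]$ is Bayes plausible with respect to $F$ if $\int_0^x G(s)\,ds\le\int_0^x F(s)\,ds$ for all $x\in[0,1]$ and $\int_0^1 s\,dG(s)=\mu$; the buyer may choose any Bayes plausible $G$. Divergence. $D_{KL}(H\|G)=\int\log(dH/dG)\,dH$ if $H$ is absolutely continuous with respect to $G$, and $+\infty$ otherwise. Given $G$, a seller belief $H$ (a probability distribution on $[0,1]$, not required to be Bayes plausible) is admissible if $D_{KL}(H\|G)\le\eta$. Seller. With belief $H$ the seller charges $p^*(H)=\min\arg\max_{p\in[c,1]}(p-c)\,\mathbb{P}_H[s\ge p]$. The buyer buys iff $s\ge p$. Buyer. The robust surplus of $G$ is $\inf_{H:\,D_{KL}(H\|G)\le\eta}\int_{p^*(H)}^1 (s-p^*(H))\,dG(s)$. The maximal robust surplus is its supremum over Bayes plausible $G$, and $G$ is buyer-optimal if it attains it. Disagreement inversion. Let $d_{KL}(x\|y)=x\log(x/y)+(1-x)\log\frac{1-x}{1-y}$. For $\tilde\eta\ge0$ and $x\in(0,1)$, $I_{\tilde\eta}(x)\in[0,1]$ is the unique value weakly below $x$ with $d_{KL}(x\|I_{\tilde\eta}(x))=\tilde\eta$; by convention $I_{\tilde\eta}(0)=0$ and $I_{\tilde\eta}(1)=e^{-\tilde\eta}$. Amplified disagreement. For $\alpha\in(1-e^{-\eta},1]$,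 $\eta^*(\alpha)=-\log\!\big(\frac{e^{-\eta}-1+\alpha}{\alpha}\big)$; for $\alpha\le1-e^{-\eta}$, $\eta^*(\alpha)=\infty$. The function $\Gamma_\eta$. For $\alpha>1-e^{-\eta}$, $$\Gamma_\eta(\alpha,r)=\min_{x\in[-c,1-c]}\ \alpha\min\{x,r\}+\mu-c-x+\int_0^{c+x}F(s)\,ds+\alpha\int_r^{\max\{x,r\}}I_{\eta^*(\alpha)}(r/t)\,dt,$$ and $\Gamma_\eta(\alpha,r)=0$ if $\alpha\le1-e^{-\eta}$. *)

theory Defs
  imports "HOL-Probability.Probability"
begin

definition dist_support :: "real measure \<Rightarrow> real set" where
  "dist_support M = {x. \<forall>U. open U \<and> x \<in> U \<longrightarrow> 0 < measure M U}"

definition unit_distribution :: "real measure \<Rightarrow> bool" where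
  "unit_distribution M \<longleftrightarrow> real_distribution M \<and> measure M {0..1} = 1"

abbreviation mean :: "real measure \<Rightarrow> real" where
  "mean M \<equiv> (\<integral>x. x \<partial>M)"

definition Bayes_plausible :: "real measure \<Rightarrow> real measure \<Rightarrow> bool" where
  "Bayes_plausible F G \<longleftrightarrow> unit_distribution G \<and>
     (\<forall>x\<in>{0..1}. integral {0..x} (cdf G) \<le> integral {0..x} (cdf F)) \<and> mean G = mean F"

text \<open>The library constant \<^const>\<open>KL_divergence\<close> takes the reference measure first, and as a Bochner
  integral it is 0 when the log-density is not integrable. The negative part of the log-density
  \<open>log (dH/dG)\<close> is always \<open>H\<close>-integrable, so in the non-integrable case the integral is \<open>\<infinity>\<close>.\<close>

definition D_KL :: "real measure \<Rightarrow> real measure \<Rightarrow> ereal" where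
  "D_KL H G =
     (if absolutely_continuous G H \<and> integrable H (entropy_density (exp 1) G H)
      then ereal (KL_divergence (exp 1) G H) else \<infinity>)"

definition admissible :: "real \<Rightarrow> real measure \<Rightarrow> real measure \<Rightarrow> bool" where
  "admissible \<eta> G H \<longleftrightarrow> unit_distribution H \<and> D_KL H G \<le> ereal \<eta>"

text \<open>The least maximiser exists: \<open>p \<mapsto> \<P>(s in H. p \<le> s)\<close> is upper semicontinuous.\<close>

definition seller_price :: "real \<Rightarrow> real measure \<Rightarrow> real" where
  "seller_price c H =
     (LEAST p. is_arg_max (\<lambda>p. (p - c) * \<P>(s in H. p \<le> s)) (\<lambda>p. p \<in> {c..1}) p)"

definition robust_surplus :: "real \<Rightarrow> real \<Rightarrow> real measure \<Rightarrow> real" where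
  "robust_surplus c \<eta> G =
     (INF H\<in>{H. admissible \<eta> G H}. LINT s:{seller_price c H..1}|G. s - seller_price c H)"

definition max_robust_surplus :: "real \<Rightarrow> real \<Rightarrow> real measure \<Rightarrow> real" where
  "max_robust_surplus c \<eta> F = (SUP G\<in>{G. Bayes_plausible F G}. robust_surplus c \<eta> G)"

definition buyer_optimal :: "real \<Rightarrow> real \<Rightarrow> real measure \<Rightarrow> real measure \<Rightarrow> bool" where
  "buyer_optimal c \<eta> F G \<longleftrightarrow>
     Bayes_plausible F G \<and> robust_surplus c \<eta> G = max_robust_surplus c \<eta> F"

definition d_KL :: "real \<Rightarrow> real \<Rightarrow> ereal" where
  "d_KL x y =
     (if y = 0 \<and> x \<noteq> 0 \<or> y = 1 \<and> x \<noteq> 1 then \<infinity>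
      else ereal (x * ln (x / y) + (1 - x) * ln ((1 - x) / (1 - y))))"

text \<open>The level is an extended real because \<open>\<eta>_star\<close> below may be \<open>\<infinity>\<close>; then the value is 0.\<close>

definition I_inv :: "ereal \<Rightarrow> real \<Rightarrow> real" where
  "I_inv e x =
     (if x = 0 then 0
      else if x = 1 then (if e = \<infinity> then 0 else exp (- real_of_ereal e))
      else (THE y. y \<in> {0..1} \<and> y \<le> x \<and> d_KL x y = e))"

definition \<eta>_star :: "real \<Rightarrow> real \<Rightarrow> ereal" where
  "\<eta>_star \<eta> \<alpha> =
     (if \<alpha> \<le> 1 - exp (- \<eta>) then \<infinity> else ereal (- ln ((exp (- \<eta>) - 1 + \<alpha>) / \<alpha>)))"

text \<open>The objective is continuous in \<open>x\<close>, so the infimum is a minimum.\<close>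

definition \<Gamma> :: "real \<Rightarrow> real \<Rightarrow> real measure \<Rightarrow> real \<Rightarrow> real \<Rightarrow> real" where
  "\<Gamma> c \<eta> F \<alpha> r =
     (if \<alpha> \<le> 1 - exp (- \<eta>) then 0
      else (INF x\<in>{- c..1 - c}.
        \<alpha> * min x r + mean F - c - x + integral {0..c + x} (cdf F)
        + \<alpha> * integral {r..max x r} (\<lambda>t. I_inv (\<eta>_star \<eta> \<alpha>) (r / t))))"

definition c_bar :: "real \<Rightarrow> real measure \<Rightarrow> real" where
  "c_bar \<eta> F =
     (if \<eta> > 0 then mean (uniform_measure F {v. the_inv_into {0..1} (cdf F) (exp (- \<eta>)) \<le> v})
      else 1)"

end

(*
Fix a Bayes plausible G with alpha = P_G(s > c). If alpha <= 1 - exp(-eta), the seller can believe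
almost only in the top signals, and no surplus survives. Otherwise let pb be the highest price
induced by an admissible belief, and let r be the conditional mean of min(s, pb) - c given s > c,
so that the robust surplus is at most E_G(s - c)^+ - alpha r. Raising the weight of {s >= p} in the
least costly way (a density that is constant on s <= c, on c < s < p and on s >= p) induces a price
above pb unless P_G(s >= p | s > c) <= I(r / (r + p - pb)), since the expectation of min(s, pb) - c
bounds every profit at a price up to pb. As r <= pb - c, integrating this bound on the tail gives
E_G(s - c)^+ <= Gamma(alpha, r).

Conversely, for a feasible pair (alpha, r) of positive value, the signal with conditional tail
I(r / (p - c)), truncated at a point c + B where its excess over c equals Gamma(alpha, r), is Bayes
plausible. By the Donsker-Varadhan inequality applied to multiples of
(p - c) 1_{s >= p} - r 1_{s > c}, every admissible belief prices at exactly c + r. The maximum over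
(alpha, r) exists because the objective is upper semicontinuous, and it is positive iff c < c_bar.
*)
theory Submission
  imports Defs "HOL-Real_Asymp.Real_Asymp"
begin

text \<open>The obstacle in the upper bound is that the price moves with the belief, and at a belief
  whose price lies below pb the profit is unknown. It is only dominated by the mean of (min(s, pb) -
  c)^+ under that belief, which is why r is a mean and not pb - c. Nothing is lost: E_G(s - pb)^+ =
  E_G(s - c)^+ - \<alpha> r is an identity, and for the optimal signal min(s, c + r) - c is
  constantly r on s > c. The level \<open>\<eta>_star\<close> has one source: a belief with
  divergence K conditional on s > c may still choose its mass on s > c, the cheapest total is - ln
  (1 - \<alpha> + \<alpha> exp (- K)), and it equals \<eta> at K =
  \<open>\<eta>_star \<eta> \<alpha>\<close>. Each x in \<open>\<Gamma>\<close> is one test of the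
  convex order, at c + x. The two constraints are room for the signal: \<open>\<Gamma>\<close> at
  least \<mu> - c puts the no-trade signal at or below c, and \<open>\<Gamma>\<close> at least
  \<alpha> r gives B \<ge> r. For \<eta> > 0 and d = 1 - exp (- \<eta>), the minimum over x of d x +
  E_F(s - c - x)^+ is d (c_bar - c), attained where c + x is the quantile; this is how the cutoff
  arises.\<close>

subsection \<open>Inverting the binary relative entropy\<close>

text \<open>With the logarithms split, the formula also makes sense at \<open>x = 0\<close> and
  \<open>x = 1\<close>, since \<open>0 * ln 0 = 0\<close>. As \<open>kl 1 y = - ln y\<close>, the
  convention for \<open>I_inv\<close> at 1 obeys the same equation
  \<open>kl x (I_inv e x) = e\<close> as the interior points.\<close>

definition kl :: "real \<Rightarrow> real \<Rightarrow> real" where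
  "kl x y = x * ln x + (1 - x) * ln (1 - x) - x * ln y - (1 - x) * ln (1 - y)"

lemma kl_self [simp]: "kl x x = 0"
  by (simp add: kl_def)

lemma kl_1 [simp]: "kl 1 y = - ln y"
  by (simp add: kl_def)

lemma d_KL_eq_kl:
  assumes "0 < x" "x < 1" "0 < y" "y < 1"
  shows "d_KL x y = ereal (kl x y)"
  using assms by (simp add: d_KL_def kl_def ln_div algebra_simps)

lemma continuous_on_x_ln_x: "continuous_on {0..} (\<lambda>x::real. x * ln x)"
proof (rule continuous_on_eq_continuous_within[THEN iffD2], intro ballI)
  fix x :: real assume x: "x \<in> {0..}"
  show "continuous (at x within {0..}) (\<lambda>x. x * ln x)"
  proof (cases "x = 0")
    case True
    have "((\<lambda>x::real. x * ln x) \<longlongrightarrow> 0) (at_right 0)" by real_asymp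
    then show ?thesis
      using True by (simp add: continuous_within at_within_Ici_at_right)
  next
    case False
    then show ?thesis using x by (intro continuous_intros) auto
  qed
qed

lemma continuous_on_kl_fst: "continuous_on {0..1} (\<lambda>x. kl x y)"
proof -
  have "continuous_on {0..1} (\<lambda>x::real. x * ln x)"
    by (rule continuous_on_subset[OF continuous_on_x_ln_x]) auto
  moreover have "continuous_on {0..1} ((\<lambda>x::real. x * ln x) \<circ> (\<lambda>x. 1 - x))"
    by (rule continuous_on_compose) (auto intro!: continuous_intros continuous_on_subset[OF continuous_on_x_ln_x])
  ultimately show ?thesis
    unfolding kl_def by (auto intro!: continuous_intros simp: o_def)
qed

lemma kl_strict_antimono_snd:
  assumes "0 < y" "y < z" "z \<le> x" "x \<le> 1" "z < 1"
  shows "kl x z < kl x y"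
proof (rule DERIV_neg_imp_decreasing_open[OF assms(2)])
  fix t assume t: "y < t" "t < z"
  have "DERIV (\<lambda>t. kl x t) t :> (t - x) / (t * (1 - t))"
    unfolding kl_def using t assms
    by (auto intro!: derivative_eq_intros simp: divide_simps) (simp add: algebra_simps)
  moreover have "(t - x) / (t * (1 - t)) < 0"
    using t assms by (intro divide_neg_pos mult_pos_pos) auto
  ultimately show "\<exists>d. DERIV (\<lambda>t. kl x t) t :> d \<and> d < 0" by blast
next
  show "continuous_on {y..z} (\<lambda>t. kl x t)"
    unfolding kl_def using assms by (intro continuous_intros) auto
qed

lemma kl_mono_fst:
  assumes "0 < y" "y < 1" "y \<le> x" "x \<le> z" "z \<le> 1"
  shows "kl x y \<le> kl z y"
proof (cases "x = z")
  case False
  then have "x < z" using assms by simp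
  then show ?thesis
  proof (rule DERIV_nonneg_imp_increasing_open[OF less_imp_le])
    fix t assume t: "x < t" "t < z"
    have "DERIV (\<lambda>t. kl t y) t :> ln t - ln (1 - t) - ln y + ln (1 - y)"
      unfolding kl_def using t assms
      by (auto intro!: derivative_eq_intros)
    moreover have "ln y \<le> ln t" "ln (1 - t) \<le> ln (1 - y)"
      using t assms by auto
    ultimately show "\<exists>d. DERIV (\<lambda>t. kl t y) t :> d \<and> 0 \<le> d" by force
  next
    show "continuous_on {x..z} (\<lambda>t. kl t y)"
      using assms by (intro continuous_on_subset[OF continuous_on_kl_fst]) auto
  qed
qed simp

lemma ex_kl_eq:
  assumes "0 < x" "x < 1" "0 \<le> e"
  shows "\<exists>y. 0 < y \<and> y \<le> x \<and> kl x y = e"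
proof -
  \<comment> \<open>\<open>w\<close> solves \<open>kl x w = e\<close> with the nonnegative term
    \<open>- (1 - x) * ln (1 - w)\<close> left out, so \<open>kl x w\<close> is at least
    \<open>e\<close>, whereas \<open>kl x x = 0\<close>.\<close>
  define w where "w = exp ((x * ln x + (1 - x) * ln (1 - x) - e) / x)"
  have neg: "x * ln x \<le> 0" "(1 - x) * ln (1 - x) \<le> 0"
    using assms by (auto simp: mult_le_0_iff)
  have "(x * ln x + (1 - x) * ln (1 - x) - e) / x \<le> (x * ln x) / x"
    using assms neg by (intro divide_right_mono) auto
  then have "w \<le> exp (ln x)" unfolding w_def exp_le_cancel_iff using assms by simp
  then have wx: "0 < w" "w \<le> x" using assms by (auto simp: w_def)
  have "x * ln w = x * ln x + (1 - x) * ln (1 - x) - e"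
    using assms by (simp add: w_def)
  then have "kl x w = e - (1 - x) * ln (1 - w)" by (simp add: kl_def)
  moreover have "(1 - x) * ln (1 - w) \<le> 0" using wx assms by (auto simp: mult_le_0_iff)
  ultimately have "e \<le> kl x w" by simp
  moreover have "continuous_on {w..x} (kl x)"
    unfolding kl_def using assms wx by (intro continuous_intros) auto
  ultimately have "\<exists>y\<ge>w. y \<le> x \<and> kl x y = e"
    using wx assms by (intro IVT2') auto
  then obtain y where "w \<le> y" "y \<le> x" "kl x y = e" by blast
  then show ?thesis using wx by (intro exI[of _ y]) linarith
qed

lemma I_inv_spec:
  assumes "0 < x" "x < 1" "0 \<le> e"
  shows "0 < I_inv (ereal e) x \<and> I_inv (ereal e) x \<le> x \<and> kl x (I_inv (ereal e) x) = e"
proof -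
  obtain y where y: "0 < y" "y \<le> x" "kl x y = e" using ex_kl_eq[OF assms] by auto
  have pos: "z \<noteq> 0" if "d_KL x z = ereal e" for z using that assms by (auto simp: d_KL_def)
  have "(THE y. y \<in> {0..1} \<and> y \<le> x \<and> d_KL x y = ereal e) = y"
  proof (rule the_equality)
    show "y \<in> {0..1} \<and> y \<le> x \<and> d_KL x y = ereal e"
      using y assms by (simp add: d_KL_eq_kl)
  next
    fix z assume z: "z \<in> {0..1} \<and> z \<le> x \<and> d_KL x z = ereal e"
    then have "0 < z" using pos[of z] by auto
    with z assms have "kl x z = e" using d_KL_eq_kl[of x z] by auto
    then show "z = y"
      using kl_strict_antimono_snd[of y z x] kl_strict_antimono_snd[of z y x] y z \<open>0 < z\<close> assms
      by (cases z y rule: linorder_cases) auto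
  qed
  then show ?thesis using y assms by (simp add: I_inv_def)
qed

lemma I_inv_0 [simp]: "I_inv e 0 = 0"
  by (simp add: I_inv_def)

lemma I_inv_1: "I_inv (ereal e) 1 = exp (- e)"
  by (simp add: I_inv_def)

lemma I_inv_bounds:
  assumes "0 < x" "x \<le> 1" "0 \<le> e"
  shows "0 < I_inv (ereal e) x" "I_inv (ereal e) x \<le> x" "kl x (I_inv (ereal e) x) = e"
  using I_inv_spec[of x e] assms by (cases "x = 1"; simp add: I_inv_1)+

lemma I_inv_nonneg: "0 \<le> x \<Longrightarrow> x \<le> 1 \<Longrightarrow> 0 \<le> e \<Longrightarrow> 0 \<le> I_inv (ereal e) x"
  using I_inv_bounds(1)[of x e] by (cases "x = 0") auto

lemma I_inv_le: "0 \<le> x \<Longrightarrow> x \<le> 1 \<Longrightarrow> 0 \<le> e \<Longrightarrow> I_inv (ereal e) x \<le> x"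
  using I_inv_bounds(2)[of x e] by (cases "x = 0") auto

text \<open>\<open>kl x\<close> decreases strictly on \<open>(0, x]\<close>, so comparing a point
  with \<open>I_inv\<close> amounts to comparing its \<open>kl\<close> with the level. Monotonicity,
  continuity and the violated tail bound are all handled in this form.\<close>

lemma I_inv_less_iff:
  assumes "0 < x" "x \<le> 1" "0 \<le> e" "0 < y" "y \<le> x" "y < 1"
  shows "I_inv (ereal e) x < y \<longleftrightarrow> kl x y < e" "y < I_inv (ereal e) x \<longleftrightarrow> e < kl x y"
proof -
  let ?i = "I_inv (ereal e) x"
  note b = I_inv_bounds[OF assms(1-3)]
  have 1: "kl x y < e" if "?i < y"
    using kl_strict_antimono_snd[of ?i y x] b that assms by auto
  have 2: "e < kl x y" if "y < ?i"
  proof (cases "?i = 1")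
    case True
    then have "x = 1" using b assms by auto
    then show ?thesis using True assms b by (auto simp: I_inv_1)
  next
    case False
    then show ?thesis using kl_strict_antimono_snd[of y ?i x] b that assms by auto
  qed
  have 3: "e = kl x y" if "y = ?i" using b that by simp
  show "?i < y \<longleftrightarrow> kl x y < e"
    using 1 2 3 by (cases "?i" y rule: linorder_cases) auto
  show "y < ?i \<longleftrightarrow> e < kl x y"
    using 1 2 3 by (cases "?i" y rule: linorder_cases) auto
qed

lemma I_inv_mono:
  assumes "0 \<le> x" "x \<le> z" "z \<le> 1" "0 \<le> e"
  shows "I_inv (ereal e) x \<le> I_inv (ereal e) z"
proof (cases "x = 0 \<or> x = z")
  case True
  then show ?thesis using assms I_inv_nonneg[of z e] by auto
next
  case False
  then have x: "0 < x" "x < 1" using assms by auto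
  note b = I_inv_bounds[of x e]
  show ?thesis
  proof (rule ccontr)
    assume "\<not> ?thesis"
    then have "kl z (I_inv (ereal e) x) < e"
      using I_inv_less_iff(1)[of z e "I_inv (ereal e) x"] x b assms by auto
    moreover have "e \<le> kl z (I_inv (ereal e) x)"
      using kl_mono_fst[of "I_inv (ereal e) x" x z] b x assms by auto
    ultimately show False by simp
  qed
qed

text \<open>The level varies along with the argument because \<alpha> varies in the maximisation
  over pairs. At a fixed test point only continuity of \<open>kl\<close> in its first argument is
  used, and this extends to \<open>x = 1\<close>.\<close>

lemma tendsto_I_inv_pos:
  assumes X: "X \<longlonglongrightarrow> x" and E: "E \<longlonglongrightarrow> e"
    and x: "0 < x" "x \<le> 1" and e: "0 \<le> e"
    and Xn: "\<And>n. 0 \<le> X n" "\<And>n. X n \<le> 1" and En: "\<And>n. 0 \<le> E n"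
  shows "(\<lambda>n. I_inv (ereal (E n)) (X n)) \<longlonglongrightarrow> I_inv (ereal e) x"
proof -
  let ?i = "I_inv (ereal e) x"
  note b = I_inv_bounds[OF x e]
  have klX: "(\<lambda>n. kl (X n) a) \<longlonglongrightarrow> kl x a" for a
    using continuous_on_tendsto_compose[OF continuous_on_kl_fst[of a] X] x Xn by simp
  show ?thesis
  proof (rule order_tendstoI)
    fix a assume a: "a < ?i"
    \<comment> \<open>\<open>I_inv_less_iff\<close> asks for a positive test point.\<close>
    define a' where "a' = max a (?i / 2)"
    have a': "0 < a'" "a' < ?i" "a \<le> a'" using a b by (auto simp: a'_def)
    then have "e < kl x a'" using I_inv_less_iff(2)[of x e a'] x e b by auto
    then have "eventually (\<lambda>n. 0 < kl (X n) a' - E n) sequentially"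
      using order_tendstoD(1)[OF tendsto_diff[OF klX[of a'] E], of 0] by auto
    moreover have "eventually (\<lambda>n. a' < X n) sequentially"
      using order_tendstoD(1)[OF X, of a'] a' b by auto
    ultimately show "eventually (\<lambda>n. a < I_inv (ereal (E n)) (X n)) sequentially"
    proof eventually_elim
      case (elim n)
      then have "a' < I_inv (ereal (E n)) (X n)"
        using I_inv_less_iff(2)[of "X n" "E n" a'] a' Xn[of n] En[of n] b x by auto
      then show ?case using a' by simp
    qed
  next
    fix a assume a: "?i < a"
    show "eventually (\<lambda>n. I_inv (ereal (E n)) (X n) < a) sequentially"
    \<comment> \<open>If \<open>I_inv\<close> equals \<open>x\<close>, no test point fits between
      the two, and the bound by \<open>X n\<close> itself takes over.\<close>
    proof (cases "?i = x")
      case True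
      then have "eventually (\<lambda>n. X n < a) sequentially" using order_tendstoD(2)[OF X] a by simp
      then show ?thesis
      proof eventually_elim
        case (elim n)
        then show ?case using I_inv_le[OF Xn En, of n n] by linarith
      qed
    next
      case False
      then have "?i < min a x" using a b by auto
      then obtain a' where a': "?i < a'" "a' < min a x" using dense by blast
      then have "kl x a' < e" using I_inv_less_iff(1)[of x e a'] x e b by auto
      then have "eventually (\<lambda>n. kl (X n) a' - E n < 0) sequentially"
        using order_tendstoD(2)[OF tendsto_diff[OF klX[of a'] E], of 0] by auto
      moreover have "eventually (\<lambda>n. a' < X n) sequentially"
        using order_tendstoD(1)[OF X, of a'] a' by auto
      ultimately show ?thesis
      proof eventually_elim
        case (elim n)
        then have "I_inv (ereal (E n)) (X n) < a'"
          using I_inv_less_iff(1)[of "X n" "E n" a'] a' Xn[of n] En[of n] b x by auto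
        then show ?case using a' by simp
      qed
    qed
  qed
qed

lemma tendsto_I_inv:
  assumes X: "X \<longlonglongrightarrow> x" and E: "E \<longlonglongrightarrow> e"
    and x: "0 \<le> x" "x \<le> 1" and e: "0 \<le> e"
    and Xn: "\<And>n. 0 \<le> X n" "\<And>n. X n \<le> 1" and En: "\<And>n. 0 \<le> E n"
  shows "(\<lambda>n. I_inv (ereal (E n)) (X n)) \<longlonglongrightarrow> I_inv (ereal e) x"
proof (cases "x = 0")
  case True
  have "(\<lambda>n. I_inv (ereal (E n)) (X n)) \<longlonglongrightarrow> 0"
    by (rule tendsto_sandwich[of "\<lambda>_. 0" _ _ X])
      (use I_inv_nonneg I_inv_le Xn En X True in \<open>auto intro!: always_eventually\<close>)
  then show ?thesis using True by simp
next
  case False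
  then show ?thesis using assms by (intro tendsto_I_inv_pos) auto
qed

lemma continuous_on_I_inv:
  assumes "0 \<le> e"
  shows "continuous_on {0..1} (I_inv (ereal e))"
  unfolding continuous_on_sequentially
  by (auto simp: o_def intro!: tendsto_I_inv assms)

lemma I_inv_zero_level:
  assumes "0 \<le> x" "x \<le> 1" shows "I_inv (ereal 0) x = x"
proof (cases "x = 0 \<or> x = 1")
  case False
  then have x: "0 < x" "x < 1" using assms by auto
  show ?thesis
    using kl_strict_antimono_snd[of "I_inv (ereal 0) x" x x] I_inv_spec[of x 0] x
    by (cases "I_inv (ereal 0) x = x") auto
qed (auto simp: I_inv_1)

lemma I_inv_less_self:
  assumes "0 < x" "x \<le> 1" "0 < e"
  shows "I_inv (ereal e) x < x"
  using I_inv_bounds[of x e] assms by (cases "I_inv (ereal e) x = x") auto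

subsection \<open>Distributions on the unit interval\<close>

locale unit_dist = real_distribution M for M :: "real measure" +
  assumes measure_unit_interval: "measure M {0..1} = 1"

lemma unit_distribution_iff: "unit_distribution M \<longleftrightarrow> unit_dist M"
  by (simp add: unit_distribution_def unit_dist_def unit_dist_axioms_def)

context unit_dist
begin

lemma AE_unit: "AE s in M. 0 \<le> s \<and> s \<le> 1"
  using AE_in_set_eq_1[of "{0..1}"] measure_unit_interval by simp

lemma integrable_bounded:
  fixes f :: "real \<Rightarrow> real"
  assumes "f \<in> borel_measurable borel" "\<And>s. 0 \<le> s \<Longrightarrow> s \<le> 1 \<Longrightarrow> \<bar>f s\<bar> \<le> B"
  shows "integrable M f"
  using AE_unit assms by (intro integrable_const_bound[of f B]) auto

lemma integrable_id: "integrable M (\<lambda>s. s)"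
  by (rule integrable_bounded[of _ 1]) auto

lemma integrable_pos_part:
  shows "integrable M (\<lambda>s. max 0 (s - a))" "integrable M (\<lambda>s. max 0 (a - s))"
  by (rule integrable_bounded[of _ "1 + \<bar>a\<bar>"]; auto)+

text \<open>Tonelli for the pairs with \<open>s \<le> t\<close> and \<open>t \<le> x\<close>. It
  turns the order constraint on integrated CDFs into a comparison of the expectations of (x - s)^+
  and, for equal means, of (s - x)^+.\<close>

lemma integral_cdf:
  assumes "0 \<le> x"
  shows "integral {0..x} (cdf M) = (\<integral>s. max 0 (x - s) \<partial>M)"
proof -
  interpret P: pair_sigma_finite M lborel ..
  have mono: "mono (cdf M)" by (auto simp: mono_def cdf_nondecreasing)
  have [measurable]: "cdf M \<in> borel_measurable borel"
    by (rule borel_measurable_mono[OF mono])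
  have m: "{s. s \<le> t} = {..t}" for t :: real by auto
  have "(\<integral>\<^sup>+s. ennreal (max 0 (x - s)) \<partial>M) = (\<integral>\<^sup>+s. (\<integral>\<^sup>+t. indicator {0..x} t * indicator {..t} s \<partial>lborel) \<partial>M)"
  proof (rule nn_integral_cong_AE)
    show "AE s in M. ennreal (max 0 (x - s)) = (\<integral>\<^sup>+t. indicator {0..x} t * indicator {..t} s \<partial>lborel)"
      using AE_unit
    proof eventually_elim
      case (elim s)
      have "(\<integral>\<^sup>+t. indicator {0..x} t * indicator {..t} s \<partial>lborel) = (\<integral>\<^sup>+t. indicator {s..x} t \<partial>lborel)"
        using elim by (intro nn_integral_cong) (auto split: split_indicator)
      also have "\<dots> = ennreal (max 0 (x - s))"
        by (cases "s \<le> x") auto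
      finally show ?case by simp
    qed
  qed
  also have "\<dots> = (\<integral>\<^sup>+t. (\<integral>\<^sup>+s. indicator {0..x} t * indicator {..t} s \<partial>M) \<partial>lborel)"
  proof (rule P.Fubini'[symmetric])
    have "(\<lambda>(s, t). indicator {0..x} t * (if s \<le> t then 1 else 0) :: ennreal) \<in> borel_measurable (borel \<Otimes>\<^sub>M borel)"
      by measurable
    also have "(\<lambda>(s, t). indicator {0..x} t * (if s \<le> t then 1 else 0) :: ennreal) = (\<lambda>(s, t). indicator {0..x} t * indicator {..t} s)"
      by (auto split: split_indicator)
    finally show "(\<lambda>(s, t). indicator {0..x} t * indicator {..t} s :: ennreal) \<in> borel_measurable (M \<Otimes>\<^sub>M lborel)"
      by (simp cong: measurable_cong_sets sets_pair_measure_cong)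
  qed
  also have "\<dots> = (\<integral>\<^sup>+t. ennreal (indicator {0..x} t * cdf M t) \<partial>lborel)"
    by (intro nn_integral_cong)
      (auto simp: nn_integral_cmult ennreal_mult emeasure_eq_measure cdf_def split: split_indicator)
  finally have eq: "(\<integral>\<^sup>+s. ennreal (max 0 (x - s)) \<partial>M) = (\<integral>\<^sup>+t. ennreal (indicator {0..x} t * cdf M t) \<partial>lborel)" .
  have "set_integrable lborel {0..x} (cdf M)"
  proof (rule set_integrable_bound[where f = "\<lambda>_. 1::real"])
    show "set_integrable lborel {0..x} (\<lambda>_. 1::real)"
      using assms by (auto simp: set_integrable_def intro!: integrable_real_indicator)
    show "set_borel_measurable lborel {0..x} (cdf M)"
      by (simp add: set_borel_measurable_def)
    show "AE t in lborel. t \<in> {0..x} \<longrightarrow> norm (cdf M t) \<le> norm (1::real)"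
      by (simp add: cdf_nonneg cdf_bounded_prob)
  qed
  then have "integral {0..x} (cdf M) = (LINT t:{0..x}|lborel. cdf M t)"
    by (rule set_borel_integral_eq_integral(2)[symmetric])
  also have "\<dots> = enn2real (\<integral>\<^sup>+t. ennreal (indicator {0..x} t * cdf M t) \<partial>lborel)"
    unfolding set_lebesgue_integral_def
    by (subst integral_eq_nn_integral) (auto simp: cdf_nonneg)
  also have "\<dots> = (\<integral>s. max 0 (x - s) \<partial>M)"
    unfolding eq[symmetric] by (rule integral_eq_nn_integral[symmetric]) auto
  finally show ?thesis .
qed

lemma excess_eq:
  assumes "0 \<le> a"
  shows "(\<integral>s. max 0 (s - a) \<partial>M) = mean M - a + integral {0..a} (cdf M)"
proof -
  have "(\<integral>s. max 0 (s - a) \<partial>M) = (\<integral>s. (s - a) + max 0 (a - s) \<partial>M)"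
    by (intro Bochner_Integration.integral_cong) auto
  also have "\<dots> = mean M - a + (\<integral>s. max 0 (a - s) \<partial>M)"
    using integrable_id integrable_pos_part prob_space by simp
  finally show ?thesis using integral_cdf[OF assms] by simp
qed

lemma surplus_eq: "(LINT s:{p..1}|M. s - p) = (\<integral>s. max 0 (s - p) \<partial>M)"
  unfolding set_lebesgue_integral_def
proof (rule integral_cong_AE)
  show "AE s in M. indicator {p..1} s *\<^sub>R (s - p) = max 0 (s - p)"
    using AE_unit by eventually_elim (auto split: split_indicator)
qed auto

end

subsection \<open>The monopoly price\<close>

text \<open>On the reals \<open>LEAST\<close> is informative only if the infimum of the maximisers
  is itself a maximiser. Sequential upper semicontinuity makes limits of maximising sequences
  maximisers, so their set is nonempty and closed.\<close>

lemma usc_least_arg_max: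
  fixes f :: "real \<Rightarrow> real"
  assumes "a \<le> b" and bd: "\<And>x. x \<in> {a..b} \<Longrightarrow> f x \<le> K"
    and usc: "\<And>X x y. (\<And>n. X n \<in> {a..b}) \<Longrightarrow> X \<longlonglongrightarrow> x \<Longrightarrow> x \<in> {a..b} \<Longrightarrow> f x < y \<Longrightarrow>
      eventually (\<lambda>n::nat. f (X n) < y) sequentially"
  shows "is_arg_max f (\<lambda>p. p \<in> {a..b}) (LEAST p. is_arg_max f (\<lambda>p. p \<in> {a..b}) p)"
    "\<And>q. is_arg_max f (\<lambda>p. p \<in> {a..b}) q \<Longrightarrow> (LEAST p. is_arg_max f (\<lambda>p. p \<in> {a..b}) p) \<le> q"
proof -
  define S where "S = Sup (f ` {a..b})"
  have bdd: "bdd_above (f ` {a..b})" using bd by (auto intro!: bdd_aboveI[of _ K])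
  have ne: "f ` {a..b} \<noteq> {}" using \<open>a \<le> b\<close> by auto
  have le_S: "f x \<le> S" if "x \<in> {a..b}" for x
    unfolding S_def using that bdd by (auto intro: cSup_upper)
  have lim: "S \<le> f x" if "\<And>n. X n \<in> {a..b}" "X \<longlonglongrightarrow> x" "(\<lambda>n. f (X n)) \<longlonglongrightarrow> S" for X x
  proof (rule ccontr)
    assume "\<not> S \<le> f x"
    then obtain y where y: "f x < y" "y < S" using dense[of "f x" S] by auto
    have "x \<in> {a..b}" using that(1,2) closed_sequentially[of "{a..b}" X x] by auto
    then have "eventually (\<lambda>n. f (X n) < y) sequentially" using usc[OF that(1,2)] y by auto
    moreover have "eventually (\<lambda>n. y < f (X n)) sequentially"
      using order_tendstoD(1)[OF that(3)] y by auto
    ultimately have "eventually (\<lambda>n. False) sequentially" by eventually_elim auto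
    then show False by simp
  qed
  define A where "A = {x \<in> {a..b}. f x = S}"
  have "\<exists>x\<in>{a..b}. S - 1 / real (Suc n) < f x" for n
  proof -
    have "S - 1 / real (Suc n) < S" by simp
    then show ?thesis unfolding S_def using less_cSupD[OF ne] by blast
  qed
  then obtain X where X: "\<And>n. X n \<in> {a..b}" "\<And>n. S - 1 / real (Suc n) < f (X n)" by metis
  have fX: "(\<lambda>n. f (X n)) \<longlonglongrightarrow> S"
  proof (rule tendsto_sandwich[of "\<lambda>n. S - 1 / real (Suc n)" _ _ "\<lambda>_. S"])
    have "(\<lambda>n. S - 1 / real (Suc n)) \<longlonglongrightarrow> S - 0"
      using LIMSEQ_inverse_real_of_nat by (intro tendsto_diff tendsto_const) (simp add: inverse_eq_divide)
    then show "(\<lambda>n. S - 1 / real (Suc n)) \<longlonglongrightarrow> S" by simp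
  qed (use X le_S in \<open>auto intro!: always_eventually less_imp_le\<close>)
  obtain l r where lr: "l \<in> {a..b}" "strict_mono r" "(X \<circ> r) \<longlonglongrightarrow> l"
    using compact_Icc[of a b] X(1) unfolding compact_def by metis
  have "S \<le> f l"
  proof (rule lim[of "X \<circ> r"])
    show "(\<lambda>n. f ((X \<circ> r) n)) \<longlonglongrightarrow> S"
      using LIMSEQ_subseq_LIMSEQ[OF fX lr(2)] by (simp add: o_def)
  qed (use X lr in auto)
  then have "l \<in> A" using lr le_S by (auto simp: A_def intro: antisym)
  then have Ane: "A \<noteq> {}" by auto
  have "closed A"
    unfolding closed_sequential_limits
  proof (intro allI impI, elim conjE)
    fix Y x assume Y: "\<forall>n. Y n \<in> A" "Y \<longlonglongrightarrow> x"
    then have "x \<in> {a..b}" using closed_sequentially[of "{a..b}" Y x] by (auto simp: A_def)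
    moreover have "S \<le> f x" using Y by (intro lim[of Y x]) (auto simp: A_def)
    ultimately show "x \<in> A" using le_S by (auto simp: A_def intro: antisym)
  qed
  moreover have bb: "bdd_below A" by (auto simp: A_def intro!: bdd_belowI[of _ a])
  ultimately have Inf: "Inf A \<in> A" using closed_contains_Inf[of A] Ane by auto
  have iff: "is_arg_max f (\<lambda>p. p \<in> {a..b}) x \<longleftrightarrow> x \<in> A" for x
  proof
    assume x: "is_arg_max f (\<lambda>p. p \<in> {a..b}) x"
    then have "f l \<le> f x" using lr by (auto simp: is_arg_max_def not_less)
    then show "x \<in> A" using x \<open>l \<in> A\<close> le_S by (auto simp: A_def is_arg_max_def intro: antisym)
  next
    assume "x \<in> A"
    then show "is_arg_max f (\<lambda>p. p \<in> {a..b}) x"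
      using le_S by (auto simp: A_def is_arg_max_def not_less)
  qed
  have "(LEAST p. p \<in> A) = Inf A"
    by (rule Least_equality) (auto simp: Inf intro: cInf_lower bb)
  then show "is_arg_max f (\<lambda>p. p \<in> {a..b}) (LEAST p. is_arg_max f (\<lambda>p. p \<in> {a..b}) p)"
    "\<And>q. is_arg_max f (\<lambda>p. p \<in> {a..b}) q \<Longrightarrow> (LEAST p. is_arg_max f (\<lambda>p. p \<in> {a..b}) p) \<le> q"
    unfolding iff using Inf by (auto intro: cInf_lower bb)
qed

context real_distribution
begin

lemma prob_ge_eq: "\<P>(s in M. p \<le> s) = measure M {p..}"
  by (intro arg_cong[where f="measure M"]) auto

lemma measure_atLeast: "measure M {p..} = 1 - measure M {..<p}"
  using prob_compl[of "{..<p}"] by (simp add: Compl_eq_Diff_UNIV[symmetric])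

lemma measure_greaterThan: "measure M {p<..} = 1 - cdf M p"
  using prob_compl[of "{..p}"] by (simp add: Compl_eq_Diff_UNIV[symmetric] cdf_def)

text \<open>The acceptance probability \<open>measure M {p..}\<close> is decreasing and
  left-continuous in \<open>p\<close>, hence upper semicontinuous.\<close>

lemma profit_usc:
  assumes c: "0 \<le> c" and X: "\<And>n. X n \<in> {c..1}" "X \<longlonglongrightarrow> p" "p \<in> {c..1}"
    and y: "(p - c) * measure M {p..} < y"
  shows "eventually (\<lambda>n::nat. (X n - c) * measure M {X n..} < y) sequentially"
proof -
  \<comment> \<open>Half of the slack suffices, because it gets multiplied by \<open>p - c\<close>,
    which is at most 1.\<close>
  define e where "e = (y - (p - c) * measure M {p..}) / 2"
  have e: "0 < e" using y by (simp add: e_def)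
  have "eventually (\<lambda>q. measure M {..<p} - e < cdf M q) (at_left p)"
    using order_tendstoD(1)[OF cdf_at_left, of "measure M {..<p} - e" p] e by simp
  then obtain q0 where q0: "q0 < p" "\<And>q. q0 < q \<Longrightarrow> q < p \<Longrightarrow> measure M {..<p} - e < cdf M q"
    unfolding eventually_at_left_field by blast
  define q where "q = (q0 + p) / 2"
  have q: "q < p" "measure M {..<p} - e < cdf M q" using q0 by (auto simp: q_def)
  have "(p - c) * (measure M {p..} + e) < y"
  proof -
    have "(p - c) * e \<le> 1 * e" using X c e by (intro mult_right_mono) auto
    then show ?thesis using e by (simp add: e_def field_simps)
  qed
  then have "eventually (\<lambda>n. (X n - c) * (measure M {p..} + e) < y) sequentially"
    by (intro order_tendstoD(2)[where y = "(p - c) * (measure M {p..} + e)"] tendsto_intros X)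
  moreover have "eventually (\<lambda>n. q < X n) sequentially"
    using order_tendstoD(1)[OF X(2) q(1)] .
  ultimately show ?thesis
  proof eventually_elim
    case (elim n)
    have "cdf M q \<le> measure M {..<X n}"
      unfolding cdf_def using elim by (intro finite_measure_mono) auto
    then have "measure M {X n..} \<le> measure M {p..} + e"
      using q by (simp add: measure_atLeast)
    then have "(X n - c) * measure M {X n..} \<le> (X n - c) * (measure M {p..} + e)"
      using X(1)[of n] by (intro mult_left_mono) auto
    then show ?case using elim by simp
  qed
qed

lemma seller_price_facts:
  assumes c: "0 \<le> c" "c \<le> 1"
  shows seller_price_mem: "seller_price c M \<in> {c..1}"
    and seller_price_max: "q \<in> {c..1} \<Longrightarrow> (q - c) * measure M {q..} \<le> (seller_price c M - c) * measure M {seller_price c M..}"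
    and seller_price_least: "q \<in> {c..1} \<Longrightarrow> (\<And>p. p \<in> {c..1} \<Longrightarrow> (p - c) * measure M {p..} \<le> (q - c) * measure M {q..})
      \<Longrightarrow> seller_price c M \<le> q"
proof -
  let ?f = "\<lambda>p. (p - c) * measure M {p..}"
  have sp: "seller_price c M = (LEAST p. is_arg_max ?f (\<lambda>p. p \<in> {c..1}) p)"
    unfolding seller_price_def prob_ge_eq ..
  have "?f x \<le> 1" if "x \<in> {c..1}" for x
    using that c by (auto intro!: mult_le_one)
  note L = usc_least_arg_max[OF c(2) this profit_usc[OF c(1)]]
  have am: "is_arg_max ?f (\<lambda>p. p \<in> {c..1}) (seller_price c M)"
    unfolding sp by (rule L(1)) auto
  then show "seller_price c M \<in> {c..1}" by (auto simp: is_arg_max_def)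
  show "?f q \<le> ?f (seller_price c M)" if "q \<in> {c..1}"
    using am that by (auto simp: is_arg_max_def not_less)
  show "seller_price c M \<le> q" if "q \<in> {c..1}" "(\<And>p. p \<in> {c..1} \<Longrightarrow> ?f p \<le> ?f q)"
    unfolding sp by (rule L(2)) (use that in \<open>auto simp: is_arg_max_def not_less\<close>)
qed

end

subsection \<open>Relative entropy balls\<close>

text \<open>For a bounded density \<open>h * ln h\<close> is bounded, so \<open>D_KL\<close> is in
  its finite branch and equals the integral. All adverse beliefs of the upper bound are built this
  way from step densities.\<close>

lemma admissible_density:
  fixes h :: "real \<Rightarrow> real"
  assumes G: "unit_distribution G" and h [measurable]: "h \<in> borel_measurable borel"
    and bd: "\<And>s. 0 \<le> h s" "\<And>s. h s \<le> C"
    and one: "(\<integral>s. h s \<partial>G) = 1" and ent: "(\<integral>s. h s * ln (h s) \<partial>G) \<le> \<eta>"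
  shows "admissible \<eta> G (density G h)"
proof -
  interpret G: unit_dist G using G by (simp add: unit_distribution_iff)
  have ih: "integrable G h" by (rule G.integrable_bounded[of _ C]) (auto simp: bd)
  have "prob_space (density G h)"
  proof
    have "emeasure (density G h) (space (density G h)) = (\<integral>\<^sup>+s. h s \<partial>G)"
      by (simp add: emeasure_density)
    also have "\<dots> = ennreal (\<integral>s. h s \<partial>G)" using ih bd by (intro nn_integral_eq_integral) auto
    finally show "emeasure (density G h) (space (density G h)) = 1" using one by simp
  qed
  then interpret H: prob_space "density G h" .
  have "unit_distribution (density G h)"
    unfolding unit_distribution_iff unit_dist_def unit_dist_axioms_def real_distribution_def real_distribution_axioms_def
  proof (intro conjI)
    have "AE s in density G h. s \<in> {0..1}"
      using G.AE_unit by (subst AE_density) (simp_all del: AE_conj_iff, erule eventually_mono, simp)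
    then show "measure (density G h) {0..1} = 1"
      using H.AE_in_set_eq_1[of "{0..1}"] by simp
  qed (auto intro: \<open>prob_space (density G h)\<close>)
  moreover have "absolutely_continuous G (density G h)"
    by (rule absolutely_continuousI_density) simp
  moreover have "KL_divergence (exp 1) G (density G h) = (\<integral>s. h s * ln (h s) \<partial>G)"
    using bd by (subst G.KL_density) (auto simp: log_def)
  moreover have "integrable (density G h) (entropy_density (exp 1) G (density G h))"
  proof -
    have "density G (RN_deriv G (density G h)) = density G h"
      using bd by (intro density_RN_deriv_density) auto
    then have eq: "AE x in G. RN_deriv G (density G h) x = h x"
      using bd by (intro G.density_unique) auto
    have ed: "entropy_density (exp 1) G (density G h) \<in> borel_measurable borel"
      using measurable_entropy_density[of "exp 1" G "density G h"] by (simp cong: measurable_cong_sets)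
    have "compact ((\<lambda>x. x * ln x) ` {0..C})"
      by (intro compact_continuous_image continuous_on_subset[OF continuous_on_x_ln_x]) auto
    then obtain D where D: "\<And>x. 0 \<le> x \<Longrightarrow> x \<le> C \<Longrightarrow> \<bar>x * ln x\<bar> \<le> D"
      unfolding compact_eq_bounded_closed bounded_iff by (force simp del: abs_mult)
    have "integrable G (\<lambda>x. h x * ln (h x))"
      by (rule G.integrable_bounded[of _ D]) (use bd D in \<open>auto simp del: abs_mult\<close>)
    moreover have "AE x in G. h x * ln (h x) = h x * entropy_density (exp 1) G (density G h) x"
      using eq bd by (auto simp: entropy_density_def log_def)
    ultimately have "integrable G (\<lambda>x. h x * entropy_density (exp 1) G (density G h) x)"
      using ed by (subst integrable_cong_AE[symmetric]) auto
    then show ?thesis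
      using ed bd by (subst integrable_real_density) auto
  qed
  ultimately show ?thesis using ent by (simp add: admissible_def D_KL_def)
qed

lemma admissible_self:
  assumes "unit_distribution G" "0 \<le> \<eta>"
  shows "admissible \<eta> G G"
proof -
  interpret G: unit_dist G using assms by (simp add: unit_distribution_iff)
  have "admissible \<eta> G (density G (\<lambda>_. ennreal 1))"
    by (rule admissible_density[of _ _ 1]) (use assms G.prob_space in auto)
  then show ?thesis by (simp add: density_1)
qed

text \<open>Donsker--Varadhan: integrate \<open>exp z \<ge> 1 + z\<close> for \<open>z = f - ln (dH/dG) + \<eta>\<close>.\<close>

lemma admissible_integral_nonpos:
  fixes f :: "real \<Rightarrow> real"
  assumes G: "unit_distribution G" and H: "admissible \<eta> G H"
    and f [measurable]: "f \<in> borel_measurable borel" and B: "\<And>s. \<bar>f s\<bar> \<le> B"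
    and le: "(\<integral>s. exp (f s) \<partial>G) \<le> exp (- \<eta>)"
  shows "(\<integral>s. f s \<partial>H) \<le> 0"
proof -
  interpret G: unit_dist G using G by (simp add: unit_distribution_iff)
  interpret H: unit_dist H using H by (simp add: unit_distribution_iff admissible_def)
  have ac: "absolutely_continuous G H" and int: "integrable H (entropy_density (exp 1) G H)"
    and KL: "KL_divergence (exp 1) G H \<le> \<eta>"
    using H by (auto simp: admissible_def D_KL_def split: if_splits)
  have sets: "sets H = sets G" by simp
  have "finite_measure H" by unfold_locales
  from G.real_RN_deriv[OF this ac sets] obtain D
    where D: "D \<in> borel_measurable G" "AE x in G. RN_deriv G H x = ennreal (D x)"
      "AE x in H. 0 < D x" "\<And>x. 0 \<le> D x" by auto
  have [measurable]: "D \<in> borel_measurable borel" using D(1) by (simp cong: measurable_cong_sets)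
  have Hd: "H = density G (\<lambda>x. ennreal (D x))"
    using G.density_RN_deriv[OF ac sets] D(1,2) density_cong[of "RN_deriv G H" G "\<lambda>x. ennreal (D x)"] by simp
  have AEH: "AE x in H. entropy_density (exp 1) G H x = ln (D x)"
    using absolutely_continuous_AE[OF sets ac D(2)] D(4)
    by (auto simp: entropy_density_def log_def elim!: eventually_mono)
  have edm: "entropy_density (exp 1) G H \<in> borel_measurable H"
    using measurable_entropy_density[of "exp 1" G H] by (simp cong: measurable_cong_sets)
  have intln: "integrable H (\<lambda>x. ln (D x))"
    using int edm AEH by (subst integrable_cong_AE[symmetric]) auto
  have KLln: "KL_divergence (exp 1) G H = (\<integral>x. ln (D x) \<partial>H)"
    unfolding KL_divergence_def using edm AEH by (intro integral_cong_AE) auto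
  have ief: "integrable G (\<lambda>x. exp (f x))"
    by (rule G.integrable_bounded[of _ "exp B"]) (use B in \<open>auto simp: abs_le_iff\<close>)
  \<comment> \<open>The \<open>H\<close>-integral of \<open>exp f / D\<close> sees only the part of
    \<open>G\<close> where \<open>D\<close> is nonzero, hence an inequality and not an identity
    below.\<close>
  have Dq: "D x * (exp (f x) / D x) = exp (f x) * indicator {x. D x \<noteq> 0} x" for x
    by (auto split: split_indicator)
  have iG: "integrable G (\<lambda>x. exp (f x) * indicator {x. D x \<noteq> 0} x)"
    using ief by (rule Bochner_Integration.integrable_bound) (auto split: split_indicator)
  have iq: "integrable H (\<lambda>x. exp (f x) / D x)"
    unfolding Hd using D(4) iG by (subst integrable_real_density) (auto simp: Dq simp del: times_divide_eq_right)
  have "(\<integral>x. exp (f x) / D x \<partial>H) = (\<integral>x. exp (f x) * indicator {x. D x \<noteq> 0} x \<partial>G)"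
    unfolding Hd using D(4) by (subst integral_real_density) (auto simp: Dq simp del: times_divide_eq_right)
  also have "\<dots> \<le> (\<integral>x. exp (f x) \<partial>G)"
    using iG ief by (rule integral_mono) (auto split: split_indicator)
  finally have 1: "(\<integral>x. exp (f x) / D x \<partial>H) \<le> exp (- \<eta>)" using le by simp
  have iff: "integrable H f"
    by (rule H.integrable_bounded[of _ B]) (use B in auto)
  have "(\<integral>x. 1 + \<eta> + f x - ln (D x) \<partial>H) \<le> (\<integral>x. exp \<eta> * (exp (f x) / D x) \<partial>H)"
  proof (rule integral_mono_AE)
    show "AE x in H. 1 + \<eta> + f x - ln (D x) \<le> exp \<eta> * (exp (f x) / D x)"
      using D(3)
    proof eventually_elim
      case (elim x)
      have "1 + (\<eta> + f x - ln (D x)) \<le> exp (\<eta> + f x - ln (D x))" by (rule exp_ge_add_one_self)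
      also have "\<dots> = exp \<eta> * (exp (f x) / D x)" using elim by (simp add: exp_add exp_diff)
      finally show ?case by simp
    qed
  qed (use iff intln integrable_mult_right[OF iq, of "exp \<eta>"] in auto)
  also have "\<dots> \<le> exp \<eta> * exp (- \<eta>)"
    using 1 by (simp del: times_divide_eq_right)
  also have "\<dots> = 1" by (simp add: exp_minus)
  also have "(\<integral>x. 1 + \<eta> + f x - ln (D x) \<partial>H) = 1 + \<eta> + (\<integral>x. f x \<partial>H) - (\<integral>x. ln (D x) \<partial>H)"
    using iff intln H.prob_space by simp
  finally show ?thesis using KL KLln by simp
qed

lemma admissible_null:
  assumes "unit_distribution G" "admissible \<eta> G H" "A \<in> sets borel" "measure G A = 0"
  shows "measure H A = 0"
proof -
  interpret G: unit_dist G using assms by (simp add: unit_distribution_iff)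
  interpret H: unit_dist H using assms by (simp add: unit_distribution_iff admissible_def)
  have "absolutely_continuous G H" using assms by (auto simp: admissible_def D_KL_def split: if_splits)
  moreover have "A \<in> null_sets G" using assms by (auto simp: G.emeasure_eq_measure)
  ultimately have "A \<in> null_sets H" by (auto simp: absolutely_continuous_def)
  then show ?thesis by (simp add: H.emeasure_eq_measure null_sets_def)
qed

text \<open>At level 0 the multiplier in the exponential bound for the tail degenerates to 0, so
  equality of the belief with \<open>G\<close> takes its place. The constant \<open>- ?k\<close>,
  tested at the belief's own level \<open>?k\<close>, shows that the divergence is nonnegative and
  thus 0.\<close>

lemma admissible_0_imp_eq:
  assumes G: "unit_distribution G" and H: "admissible 0 G H"
  shows "H = G"
proof -
  interpret G: unit_dist G using G by (simp add: unit_distribution_iff)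
  interpret H: unit_dist H using H by (simp add: unit_distribution_iff admissible_def)
  interpret G: information_space G "exp 1" by standard simp
  have ac: "absolutely_continuous G H" and int: "integrable H (entropy_density (exp 1) G H)"
    and KL: "KL_divergence (exp 1) G H \<le> 0"
    using H by (auto simp: admissible_def D_KL_def split: if_splits)
  let ?k = "KL_divergence (exp 1) G H"
  have adm: "admissible ?k G H"
    using ac int H by (simp add: admissible_def D_KL_def)
  have "(\<integral>s. - ?k \<partial>H) \<le> 0"
    by (rule admissible_integral_nonpos[OF G adm, of _ "\<bar>?k\<bar>"]) (auto simp: G.prob_space)
  then have "?k = 0" using KL H.prob_space by simp
  then show ?thesis
    using G.KL_eq_0_iff_eq_ac[OF _ ac _ int] H.prob_space_axioms by simp
qed

text \<open>The real value of \<open>\<eta>_star\<close> above the threshold: the solution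
  \<open>e\<close> of \<open>1 - \<alpha> + \<alpha> * exp (- e) = exp (- \<eta>)\<close>.\<close>

definition eta_adj :: "real \<Rightarrow> real \<Rightarrow> real" where
  "eta_adj \<eta> \<alpha> = - ln ((exp (- \<eta>) - 1 + \<alpha>) / \<alpha>)"

context unit_dist
begin

lemma integrable_indicator [simp]: "A \<in> sets borel \<Longrightarrow> integrable M (\<lambda>s. indicator A s :: real)"
  by (rule integrable_bounded[of _ 1]) (auto split: split_indicator)

lemma integral_two_indicators:
  fixes a b d :: real
  assumes "A \<in> sets borel" "B \<in> sets borel"
  shows "(\<integral>s. a + b * indicator A s + d * indicator B s \<partial>M) = a + b * measure M A + d * measure M B"
proof -
  have [simp]: "integrable M (\<lambda>s. b * indicator A s)" "integrable M (\<lambda>s. d * indicator B s)"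
    using assms by auto
  show ?thesis using assms prob_space by simp
qed

end

section \<open>The expression minimised in \<open>\<Gamma>\<close> and its elementary bounds\<close>

locale market =
  fixes c \<eta> \<mu> :: real and F :: "real measure"
  assumes c_pos: "0 < c" and c_le: "c \<le> 1" and eta_nonneg: "0 \<le> \<eta>"
    and unit_F: "unit_dist F" and mean_F: "mean F = \<mu>"
begin

sublocale F: unit_dist F by (rule unit_F)

definition J :: "real \<Rightarrow> real \<Rightarrow> real" where
  "J \<alpha> x = I_inv (ereal (eta_adj \<eta> \<alpha>)) x"

text \<open>The expected excess of \<open>s\<close> over \<open>c + x\<close> under
  \<open>F\<close>, in the form in which it stands in \<open>\<Gamma>\<close>; see
  \<open>eF_excess\<close>.\<close>

definition eF :: "real \<Rightarrow> real" where
  "eF x = \<mu> - c - x + integral {0..c + x} (cdf F)"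

text \<open>A bound on the expected excess over \<open>c\<close>, obtained by cutting at
  \<open>c + x\<close>: \<open>eF x\<close> is for the part above the cut, the other terms are for
  the part below it.\<close>

definition obj :: "real \<Rightarrow> real \<Rightarrow> real \<Rightarrow> real" where
  "obj \<alpha> r x = \<alpha> * min x r + eF x + \<alpha> * integral {r..max x r} (\<lambda>t. J \<alpha> (r / t))"

lemma exp_eta_le_1: "exp (- \<eta>) \<le> 1" using eta_nonneg by simp

lemma alpha_pos: "1 - exp (- \<eta>) < \<alpha> \<Longrightarrow> 0 < \<alpha>"
  using exp_eta_le_1 by linarith

lemma eta_adj_nonneg:
  assumes "1 - exp (- \<eta>) < \<alpha>" shows "0 \<le> eta_adj \<eta> \<alpha>"
proof -
  have "(exp (- \<eta>) - 1 + \<alpha>) / \<alpha> \<le> 1"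
    using alpha_pos[OF assms] exp_eta_le_1 by (simp add: divide_le_eq)
  moreover have "0 < (exp (- \<eta>) - 1 + \<alpha>) / \<alpha>"
    using alpha_pos[OF assms] assms by simp
  ultimately show ?thesis unfolding eta_adj_def by simp
qed

lemma exp_eta_adj:
  assumes "1 - exp (- \<eta>) < \<alpha>"
  shows "\<alpha> * exp (- eta_adj \<eta> \<alpha>) = exp (- \<eta>) - 1 + \<alpha>"
  using alpha_pos[OF assms] assms by (simp add: eta_adj_def)

lemma eta_star_eq: "1 - exp (- \<eta>) < \<alpha> \<Longrightarrow> \<eta>_star \<eta> \<alpha> = ereal (eta_adj \<eta> \<alpha>)"
  by (simp add: \<eta>_star_def eta_adj_def)

lemma J_0 [simp]: "J \<alpha> 0 = 0" by (simp add: J_def)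

lemma J_bounds:
  assumes "1 - exp (- \<eta>) < \<alpha>" "0 \<le> x" "x \<le> 1"
  shows J_nonneg: "0 \<le> J \<alpha> x" and J_le: "J \<alpha> x \<le> x"
  unfolding J_def using I_inv_nonneg I_inv_le eta_adj_nonneg assms by auto

lemma J_mono:
  assumes "1 - exp (- \<eta>) < \<alpha>" "0 \<le> x" "x \<le> y" "y \<le> 1"
  shows "J \<alpha> x \<le> J \<alpha> y"
  unfolding J_def using I_inv_mono eta_adj_nonneg assms by auto

lemma ratio_bounds:
  fixes r t :: real
  assumes "0 \<le> r" "r \<le> t" shows "0 \<le> r / t" "r / t \<le> 1"
  using assms by (auto simp: divide_le_eq_1)

lemma J_ratio_antimono:
  assumes "1 - exp (- \<eta>) < \<alpha>" "0 \<le> r" "r \<le> s" "s \<le> t"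
  shows "J \<alpha> (r / t) \<le> J \<alpha> (r / s)"
proof (cases "r = 0")
  case False
  then show ?thesis using assms by (intro J_mono) (auto simp: divide_left_mono divide_le_eq_1)
qed simp

lemma J_integrable:
  assumes "1 - exp (- \<eta>) < \<alpha>" "0 \<le> r" "r \<le> a"
  shows "(\<lambda>t. J \<alpha> (r / t)) integrable_on {a..b}"
proof -
  have "(\<lambda>t. - J \<alpha> (r / t)) integrable_on {a..b}"
    by (rule integrable_on_mono_on) (use assms J_ratio_antimono in \<open>auto simp: mono_on_def\<close>)
  then show ?thesis using integrable_neg_iff by fastforce
qed

lemma J_integral_nonneg:
  assumes "1 - exp (- \<eta>) < \<alpha>" "0 \<le> r" "r \<le> a"
  shows "0 \<le> integral {a..b} (\<lambda>t. J \<alpha> (r / t))"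
  by (rule Henstock_Kurzweil_Integration.integral_nonneg[OF J_integrable[OF assms]])
    (use assms J_nonneg ratio_bounds in auto)

lemma Gamma_eq:
  assumes "1 - exp (- \<eta>) < \<alpha>"
  shows "\<Gamma> c \<eta> F \<alpha> r = (INF x\<in>{- c..1 - c}. obj \<alpha> r x)"
  using assms mean_F by (simp add: \<Gamma>_def obj_def eF_def J_def eta_star_eq algebra_simps)

lemma cdf_integrable: "unit_dist M \<Longrightarrow> cdf M integrable_on {a..b}"
  by (intro integrable_on_mono_on)
    (auto simp: mono_on_def unit_dist_def real_distribution.axioms
      intro!: finite_borel_measure.cdf_nondecreasing real_distribution.finite_borel_measure_M)

lemma cdf_integral_nonneg: "unit_dist M \<Longrightarrow> 0 \<le> integral {a..b} (cdf M)"
  by (intro Henstock_Kurzweil_Integration.integral_nonneg cdf_integrable) (auto simp: cdf_def)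

text \<open>A crude bound, there to make the set under \<open>INF\<close> bounded below; without it
  the real infimum would carry no information.\<close>

lemma obj_lower:
  assumes "1 - exp (- \<eta>) < \<alpha>" "\<alpha> \<le> 1" "0 \<le> r" "x \<in> {- c..1 - c}"
  shows "\<mu> - 2 \<le> obj \<alpha> r x"
proof -
  have "\<alpha> * (- c) \<le> \<alpha> * min x r" using alpha_pos[OF assms(1)] assms c_pos by (intro mult_left_mono) auto
  moreover have "- 1 \<le> \<alpha> * (- c)" using mult_mono[of \<alpha> 1 c 1] alpha_pos[OF assms(1)] assms c_pos c_le by auto
  moreover have "\<mu> - 1 \<le> eF x" using cdf_integral_nonneg[OF unit_F, of 0 "c + x"] assms by (simp add: eF_def)
  moreover have "0 \<le> \<alpha> * integral {r..max x r} (\<lambda>t. J \<alpha> (r / t))"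
    using J_integral_nonneg[of \<alpha> r r] alpha_pos[OF assms(1)] assms by simp
  ultimately show ?thesis unfolding obj_def by linarith
qed

lemma Gamma_le_obj:
  assumes "1 - exp (- \<eta>) < \<alpha>" "\<alpha> \<le> 1" "0 \<le> r" "x \<in> {- c..1 - c}"
  shows "\<Gamma> c \<eta> F \<alpha> r \<le> obj \<alpha> r x"
  unfolding Gamma_eq[OF assms(1)]
  using obj_lower[OF assms(1-3)] assms(4) by (intro cINF_lower bdd_belowI2[where m = "\<mu> - 2"]) auto

lemma le_Gamma:
  assumes "1 - exp (- \<eta>) < \<alpha>" "\<And>x. x \<in> {- c..1 - c} \<Longrightarrow> M \<le> obj \<alpha> r x"
  shows "M \<le> \<Gamma> c \<eta> F \<alpha> r"
  unfolding Gamma_eq[OF assms(1)] using assms(2) by (intro cINF_greatest) auto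

subsection \<open>Upper bound on the robust surplus\<close>

lemma robust_surplus_le:
  assumes G: "unit_distribution G" and H: "admissible \<eta> G H"
  shows "robust_surplus c \<eta> G \<le> (\<integral>s. max 0 (s - seller_price c H) \<partial>G)"
proof -
  interpret G: unit_dist G using G by (simp add: unit_distribution_iff)
  have "robust_surplus c \<eta> G \<le> (LINT s:{seller_price c H..1}|G. s - seller_price c H)"
    unfolding robust_surplus_def
  proof (rule cINF_lower)
    show "bdd_below ((\<lambda>H. LINT s:{seller_price c H..1}|G. s - seller_price c H) ` {H. admissible \<eta> G H})"
      by (rule bdd_belowI2[where m = 0]) (simp add: G.surplus_eq)
  qed (use H in simp)
  then show ?thesis by (simp add: G.surplus_eq)
qed

lemma measure_density_eq:
  fixes h :: "real \<Rightarrow> real"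
  assumes "unit_distribution (density G h)" "unit_dist G" "h \<in> borel_measurable borel" "\<And>s. 0 \<le> h s"
    "A \<in> sets borel"
  shows "measure (density G h) A = (\<integral>s. h s * indicator A s \<partial>G)"
proof -
  interpret G: unit_dist G by fact
  have "measure (density G h) A = (\<integral>s. indicator A s \<partial>density G h)" using assms by simp
  also have "\<dots> = (\<integral>s. h s * indicator A s \<partial>G)"
    using assms by (subst integral_real_density) (auto cong: measurable_cong_sets)
  finally show ?thesis .
qed

text \<open>The adverse belief keeps density 1 above \<open>p\<close>, gives density 0 to
  \<open>(c, p]\<close> and moves the freed mass to \<open>s \<le> c\<close>, at a cost of at most
  \<open>- ln (1 - \<alpha>)\<close>. All prices in \<open>(c, p]\<close> then sell equally often,
  so the price is at least \<open>p\<close>, and \<open>p\<close> is chosen within \<open>e\<close>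
  of the highest signals.\<close>

lemma no_surplus_if_rarely_above_cost:
  assumes G: "unit_distribution G" and a: "measure G {c<..} \<le> 1 - exp (- \<eta>)"
  shows "robust_surplus c \<eta> G \<le> 0"
proof (cases "measure G {c<..} = 0")
  case True
  interpret G: unit_dist G using G by (simp add: unit_distribution_iff)
  have "seller_price c G \<in> {c..1}" using G.seller_price_mem c_pos c_le by simp
  moreover have "AE s in G. s \<notin> {c<..}"
    using True G.prob_eq_0[of "{c<..}"] by simp
  ultimately have "(\<integral>s. max 0 (s - seller_price c G) \<partial>G) = (\<integral>s. 0 \<partial>G)"
    by (intro integral_cong_AE) (auto elim!: eventually_mono)
  then show ?thesis using robust_surplus_le[OF G admissible_self[OF G eta_nonneg]] by simp
next
  case False
  interpret G: unit_dist G using G by (simp add: unit_distribution_iff)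
  define \<alpha> where "\<alpha> = measure G {c<..}"
  have al: "exp (- \<eta>) \<le> 1 - \<alpha>" "\<alpha> < 1" "0 < \<alpha>"
    using a False exp_gt_zero[of "- \<eta>"] zero_less_measure_iff[of G "{c<..}"] by (auto simp: \<alpha>_def simp del: exp_gt_zero)
  show ?thesis
  proof (rule field_le_epsilon)
    fix e :: real assume e: "0 < e"
    \<comment> \<open>On the grid of mesh \<open>e\<close> above \<open>c\<close>, the last point
      with mass above it becomes \<open>p\<close>; no mass is left above
      \<open>p + e\<close>.\<close>
    define P where "P k \<longleftrightarrow> 0 < measure G {c + real k * e<..}" for k
    have above1: "measure G {x<..} = 0" if "1 \<le> x" for x
    proof -
      have "AE s in G. s \<notin> {x<..}" using G.AE_unit by eventually_elim (use that in auto)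
      then show ?thesis by (subst G.prob_eq_0) auto
    qed
    obtain n where "1 \<le> real n * e" using e by (metis reals_Archimedean3 less_imp_le mult.commute)
    then have "\<not> P n" using above1[of "c + real n * e"] c_pos by (simp add: P_def)
    moreover have "P 0" using al by (simp add: P_def \<alpha>_def)
    ultimately obtain k where k: "P k" "\<not> P (Suc k)" by (metis (no_types) nat_induct)
    define p where "p = c + real k * e"
    define g where "g = measure G {p<..}"
    have p: "c \<le> p" "0 < g" "measure G {p + e<..} = 0"
      using k e zero_less_measure_iff[of G] by (auto simp: P_def p_def g_def algebra_simps)
    have p1: "p \<le> 1" using above1[of p] p by (cases "p \<le> 1") (auto simp: g_def)
    have ga: "g \<le> \<alpha>" unfolding g_def \<alpha>_def using p by (intro G.finite_measure_mono) auto
    define h0 where "h0 = (1 - g) / (1 - \<alpha>)"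
    have h0: "1 \<le> h0" using ga al by (simp add: h0_def)
    define h where "h s = h0 * indicator {..c} s + indicator {p<..} s" for s
    have hm [measurable]: "h \<in> borel_measurable borel" unfolding h_def by measurable
    have hb: "0 \<le> h s" "h s \<le> h0" for s
      using h0 p by (auto simp: h_def split: split_indicator)
    have mc: "measure G {..c} = 1 - \<alpha>"
      using G.measure_greaterThan[of c] by (simp add: \<alpha>_def cdf_def)
    have ih: "(\<integral>s. h s \<partial>G) = 1"
    proof -
      have "(\<integral>s. h s \<partial>G) = h0 * (1 - \<alpha>) + g" 
        using G.integral_two_indicators[of "{..c}" "{p<..}" 0 h0 1] mc by (simp add: g_def h_def)
      then show ?thesis using al by (simp add: h0_def)
    qed
    \<comment> \<open>Density values 0 and 1 contribute nothing, so only \<open>s \<le> c\<close>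
      carries divergence.\<close>
    have lnh: "h s * ln (h s) = h0 * ln h0 * indicator {..c} s" for s
      using p by (auto simp: h_def split: split_indicator)
    have "(\<integral>s. h s * ln (h s) \<partial>G) = (1 - g) * ln h0"
      unfolding lnh using mc al by (simp add: h0_def)
    also have "\<dots> \<le> 1 * ln (1 / (1 - \<alpha>))"
      using p h0 al ga by (intro mult_mono) (auto simp: h0_def divide_right_mono)
    also have "\<dots> = - ln (1 - \<alpha>)" using al by (simp add: ln_div)
    also have "\<dots> \<le> \<eta>" using al ln_mono[OF al(1)] by simp
    finally have adm: "admissible \<eta> G (density G h)"
      by (intro admissible_density[OF G hm hb ih])
    define H where "H = density G h"
    have uH: "unit_distribution H" using adm by (simp add: admissible_def H_def)
    interpret H: unit_dist H using uH by (simp add: unit_distribution_iff)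
    have Hq: "measure H {q..} = g" if "c < q" "q \<le> p" for q
    proof -
      have "h s * indicator {q..} s = indicator {p<..} s" for s
        using that by (auto simp: h_def split: split_indicator)
      then show ?thesis
        unfolding H_def using measure_density_eq[of G h "{q..}"] uH H_def G.unit_dist_axioms hb
        by (simp add: g_def)
    qed
    have "p \<le> seller_price c H"
    proof (rule ccontr)
      assume lt: "\<not> p \<le> seller_price c H"
      have mem: "seller_price c H \<in> {c..1}" using H.seller_price_mem c_pos c_le by simp
      have "(p - c) * measure H {p..} \<le> (seller_price c H - c) * measure H {seller_price c H..}"
        using H.seller_price_max[of c p] c_pos c_le p p1 by simp
      then have 1: "(p - c) * g \<le> (seller_price c H - c) * measure H {seller_price c H..}"
        using Hq[of p] lt mem by auto
      show False
      proof (cases "seller_price c H = c")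
        case True
        then show ?thesis using 1 p lt by (simp add: mult_le_0_iff)
      next
        case False
        then show ?thesis using 1 Hq[of "seller_price c H"] lt mem p by simp
      qed
    qed
    have "robust_surplus c \<eta> G \<le> (\<integral>s. max 0 (s - seller_price c H) \<partial>G)"
      using robust_surplus_le[OF G adm] by (simp add: H_def)
    also have "\<dots> \<le> (\<integral>s. e \<partial>G)"
    proof (rule integral_mono_AE)
      have "AE s in G. s \<notin> {p + e<..}" using p G.prob_eq_0[of "{p + e<..}"] by simp
      then show "AE s in G. max 0 (s - seller_price c H) \<le> e"
        by eventually_elim (use \<open>p \<le> seller_price c H\<close> e in auto)
    qed (use G.integrable_pos_part in auto)
    finally show "robust_surplus c \<eta> G \<le> 0 + e" using G.prob_space by simp
  qed
qed

lemma three_level_integral: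
  assumes G: "unit_dist G" and p: "c < p"
  shows "(\<integral>s. (if s \<le> c then a else if s < p then b else d) \<partial>G) =
    a * (1 - measure G {c<..}) + b * (measure G {c<..} - measure G {p..}) + (d::real) * measure G {p..}"
proof -
  interpret G: unit_dist G by fact
  have eq: "(if s \<le> c then a else if s < p then b else d) = a + (b - a) * indicator {c<..} s + (d - b) * indicator {p..} s" for s
    using p by (auto split: split_indicator)
  show ?thesis unfolding eq
    by (subst G.integral_two_indicators) (simp_all add: algebra_simps)
qed

text \<open>If the belief has conditional weight \<open>x\<close> on \<open>{p..}\<close>, pricing
  at \<open>p\<close> instead of at most \<open>pb\<close> gains at least \<open>p - pb\<close> per
  unit of \<open>x\<close>, and loses at most \<open>r\<close> per unit of \<open>1 - x\<close>. The
  break-even weight, where \<open>x * (p - pb) = (1 - x) * r\<close>, is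
  \<open>r / (r + (p - pb))\<close>; a larger tail under \<open>G\<close> would make a weight beyond
  break-even affordable.\<close>

lemma tail_bound:
  assumes G: "unit_distribution G" and al: "1 - exp (- \<eta>) < measure G {c<..}"
    and pb: "pb \<in> {c..1}" and price: "\<And>H. admissible \<eta> G H \<Longrightarrow> seller_price c H \<le> pb"
    and r: "measure G {c<..} * r = (\<integral>s. max 0 (min (s - c) (pb - c)) \<partial>G)"
    and p: "pb < p" "p \<le> 1"
  shows "measure G {p..} \<le> measure G {c<..} * J (measure G {c<..}) (r / (r + (p - pb)))"
proof (rule ccontr)
  interpret G: unit_dist G using G by (simp add: unit_distribution_iff)
  define \<alpha> where "\<alpha> = measure G {c<..}"
  define m where "m s = max 0 (min (s - c) (pb - c))" for s
  define Y where "Y = measure G {p..}"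
  define y where "y = Y / \<alpha>"
  define \<sigma> where "\<sigma> = p - pb"
  define x0 where "x0 = r / (r + \<sigma>)"
  have al': "1 - exp (- \<eta>) < \<alpha>" "0 < \<alpha>" "\<alpha> \<le> 1" using al alpha_pos by (auto simp: \<alpha>_def)
  have ar: "\<alpha> * r = (\<integral>s. m s \<partial>G)" using r by (simp add: \<alpha>_def m_def)
  assume "\<not> ?thesis"
  then have yI: "J \<alpha> x0 < y" using al' by (simp add: \<alpha>_def[symmetric] Y_def[symmetric] x0_def \<sigma>_def y_def less_divide_eq mult.commute)
  have Yay: "Y = \<alpha> * y" using al' by (simp add: y_def)
  have Y\<alpha>: "Y \<le> \<alpha>" unfolding Y_def \<alpha>_def using p pb by (intro G.finite_measure_mono) auto
  have y01: "0 \<le> y" "y \<le> 1" using al' Y\<alpha> by (auto simp: y_def Y_def)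
  have \<sigma>: "0 < \<sigma>" using p by (simp add: \<sigma>_def)
  have [measurable]: "m \<in> borel_measurable borel" unfolding m_def by measurable
  have im: "integrable G m" by (rule G.integrable_bounded[of _ 1]) (use pb c_pos in \<open>auto simp: m_def\<close>)
  have r0: "0 \<le> r"
  proof -
    have "0 \<le> \<alpha> * r" unfolding ar by (rule Bochner_Integration.integral_nonneg) (simp add: m_def)
    then show ?thesis using al' by (simp add: zero_le_mult_iff)
  qed
  have "\<alpha> * r \<le> (\<integral>s. (pb - c) * indicator {c<..} s \<partial>G)"
    unfolding ar using im pb by (intro integral_mono) (auto simp: m_def split: split_indicator)
  then have rt: "r \<le> pb - c" using al' by (simp add: \<alpha>_def mult.commute)
  have x0: "0 \<le> x0" "x0 < 1" using r0 \<sigma> by (auto simp: x0_def)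
  have price_H: "(p - c) * measure H {p..} \<le> (\<integral>s. m s \<partial>H)" if adm: "admissible \<eta> G H" for H
  proof -
    have "unit_distribution H" using adm by (simp add: admissible_def)
    then interpret H: unit_dist H by (simp add: unit_distribution_iff)
    define q where "q = seller_price c H"
    have q: "q \<in> {c..pb}" using price[OF adm] H.seller_price_mem[of c] c_pos c_le by (auto simp: q_def)
    have "(p - c) * measure H {p..} \<le> (q - c) * measure H {q..}"
      using H.seller_price_max[of c p] c_pos c_le p pb by (auto simp: q_def)
    also have "\<dots> = (\<integral>s. (q - c) * indicator {q..} s \<partial>H)" by simp
    also have "\<dots> \<le> (\<integral>s. m s \<partial>H)"
    proof (rule integral_mono)
      show "integrable H m" by (rule H.integrable_bounded[of _ 1]) (use pb c_pos in \<open>auto simp: m_def\<close>)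
    qed (use q in \<open>auto simp: m_def split: split_indicator\<close>)
    finally show ?thesis .
  qed
  \<comment> \<open>\<open>G\<close> is itself admissible. This places \<open>y\<close> at or below
    \<open>x0\<close>, the range in which \<open>I_inv_less_iff\<close> applies.\<close>
  have "(p - c) * Y \<le> \<alpha> * r"
    using price_H[OF admissible_self[OF G eta_nonneg]] ar by (simp add: Y_def)
  then have "\<alpha> * ((p - c) * y) \<le> \<alpha> * r" by (simp add: Yay mult.left_commute)
  then have "(p - c) * y \<le> r" using al' by simp
  moreover have "(p - c) * y = (pb - c) * y + \<sigma> * y" by (simp add: \<sigma>_def algebra_simps)
  moreover have "r * y \<le> (pb - c) * y" using rt y01 by (intro mult_right_mono)
  ultimately have "y * (r + \<sigma>) \<le> r" by (simp add: algebra_simps)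
  then have yx0: "y \<le> x0" using r0 \<sigma> by (simp add: x0_def le_divide_eq)
  have y: "0 < y" "y < 1" using yI J_nonneg[OF al'(1), of x0] x0 yx0 by auto
  have x0p: "0 < x0" using y yx0 by simp
  \<comment> \<open>A weight strictly beyond break-even, so that the final inequality fails; by
    continuity of \<open>J\<close> it is still affordable.\<close>
  obtain x where x: "x0 < x" "x < 1" "J \<alpha> x < y"
  proof -
    define X where "X n = x0 + (1 - x0) / 2 * inverse (real (Suc n))" for n :: nat
    have "X \<longlonglongrightarrow> x0 + (1 - x0) / 2 * 0" unfolding X_def by (intro tendsto_intros LIMSEQ_inverse_real_of_nat)
    then have lim: "X \<longlonglongrightarrow> x0" by simp
    have X: "x0 < X n" "X n < 1" for n
    proof -
      show "x0 < X n" using x0 by (simp add: X_def)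
      have "(1 - x0) / 2 * inverse (real (Suc n)) \<le> (1 - x0) / 2 * 1"
        using x0 by (intro mult_left_mono) (auto simp: inverse_le_1_iff)
      then have "X n \<le> x0 + (1 - x0) / 2" unfolding X_def by linarith
      moreover have "x0 + (1 - x0) / 2 < 1" using x0 by (simp add: field_simps)
      ultimately show "X n < 1" by (rule le_less_trans)
    qed
    have "(\<lambda>n. I_inv (ereal (eta_adj \<eta> \<alpha>)) (X n)) \<longlonglongrightarrow> I_inv (ereal (eta_adj \<eta> \<alpha>)) x0"
      by (rule tendsto_I_inv) (use lim x0 X eta_adj_nonneg[OF al'(1)] in \<open>auto intro: less_imp_le less_trans le_less_trans\<close>)
    then have "eventually (\<lambda>n. J \<alpha> (X n) < y) sequentially"
      using yI order_tendstoD(2) unfolding J_def by blast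
    then obtain n where "J \<alpha> (X n) < y" by (auto simp: eventually_sequentially)
    then show ?thesis using that X by blast
  qed
  define K where "K = kl x y"
  have "K < eta_adj \<eta> \<alpha>"
    unfolding K_def using I_inv_less_iff(1)[of x "eta_adj \<eta> \<alpha>" y] x y x0p yx0 eta_adj_nonneg[OF al'(1)]
    by (simp add: J_def)
  then have eK: "exp (- \<eta>) - 1 + \<alpha> \<le> \<alpha> * exp (- K)"
    using exp_eta_adj[OF al'(1)] al' by (metis exp_le_cancel_iff less_imp_le mult_left_mono neg_le_iff_le)
  \<comment> \<open>\<open>Z\<close> normalises the weights 1 on \<open>s \<le> c\<close> and
    \<open>exp (- K)\<close> on \<open>s > c\<close>, which is the cheapest division of mass given
    conditional divergence \<open>K\<close>.\<close>
  define Z where "Z = 1 - \<alpha> + \<alpha> * exp (- K)"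
  have Z: "0 < Z" "exp (- \<eta>) \<le> Z"
    using al' eK by (auto simp: Z_def intro: add_nonneg_pos)
  define k where "k = exp (- K) / Z"
  define h1 h2 where "h1 = k * ((1 - x) / (1 - y))" and "h2 = k * (x / y)"
  have pos: "0 < k" "0 < h1" "0 < h2" using Z x y x0 by (auto simp: k_def h1_def h2_def)
  \<comment> \<open>the cheapest tilt of \<open>G\<close> that puts conditional weight \<open>x\<close> on \<open>{p..}\<close>; its relative entropy is \<open>- ln Z\<close>\<close>
  define h where "h s = (if s \<le> c then 1 / Z else if s < p then h1 else h2)" for s
  have cp: "c < p" using p pb by simp
  have hm [measurable]: "h \<in> borel_measurable borel" unfolding h_def by measurable
  have hb: "0 \<le> h s" "h s \<le> 1 / Z + h1 + h2" for s
    using pos Z by (auto simp: h_def)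
  note TL = three_level_integral[OF G.unit_dist_axioms cp, folded \<alpha>_def Y_def]
  have mass: "h1 * (\<alpha> - Y) + h2 * Y = k * \<alpha>"
  proof -
    have "h1 * (\<alpha> - Y) = k * \<alpha> * (1 - x)" using y by (simp add: h1_def Yay field_simps)
    moreover have "h2 * Y = k * \<alpha> * x" using y by (simp add: h2_def Yay)
    ultimately show ?thesis by (simp add: algebra_simps)
  qed
  have kZ: "1 / Z * (1 - \<alpha>) + k * \<alpha> = 1"
  proof -
    have "1 / Z * (1 - \<alpha>) + k * \<alpha> = (1 - \<alpha> + \<alpha> * exp (- K)) / Z"
      by (simp add: k_def add_divide_distrib mult.commute)
    then show ?thesis using Z by (simp add: Z_def[symmetric])
  qed
  have one: "(\<integral>s. h s \<partial>G) = 1" unfolding h_def TL using mass kZ by simp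
  have "(\<integral>s. h s * ln (h s) \<partial>G) = - ln Z"
  proof -
    have "h s * ln (h s) = (if s \<le> c then 1 / Z * - ln Z else if s < p then h1 * ln h1 else h2 * ln h2)" for s
      using Z by (simp add: h_def ln_div)
    then have e1: "(\<integral>s. h s * ln (h s) \<partial>G) = 1 / Z * - ln Z * (1 - \<alpha>) + h1 * ln h1 * (\<alpha> - Y) + h2 * ln h2 * Y"
      by (simp only: TL)
    have e2: "h1 * ln h1 * (\<alpha> - Y) + h2 * ln h2 * Y = k * \<alpha> * (- ln Z)"
    proof -
      have lk: "ln k = - K - ln Z" using Z by (simp add: k_def ln_div)
      have l1: "ln h1 = ln k + ln (1 - x) - ln (1 - y)" and l2: "ln h2 = ln k + ln x - ln y"
        unfolding h1_def h2_def using pos x y x0 by (simp_all add: ln_mult ln_div)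
      have a1: "h1 * (\<alpha> - Y) = k * \<alpha> * (1 - x)" using y by (simp add: h1_def Yay field_simps)
      have a2: "h2 * Y = k * \<alpha> * x" using y by (simp add: h2_def Yay)
      have "h1 * ln h1 * (\<alpha> - Y) + h2 * ln h2 * Y = (h1 * (\<alpha> - Y)) * ln h1 + (h2 * Y) * ln h2"
        by (simp add: algebra_simps)
      also have "\<dots> = k * \<alpha> * (ln k + K)"
        unfolding a1 a2 l1 l2 K_def kl_def by (simp add: algebra_simps)
      finally show ?thesis by (simp add: lk)
    qed
    have "(\<integral>s. h s * ln (h s) \<partial>G) = 1 / Z * - ln Z * (1 - \<alpha>) + k * \<alpha> * (- ln Z)"
      using e1 e2 by linarith
    also have "\<dots> = - ln Z * (1 / Z * (1 - \<alpha>) + k * \<alpha>)"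
      by (simp only: distrib_left mult.commute mult.left_commute)
    finally have "(\<integral>s. h s * ln (h s) \<partial>G) = - ln Z * (1 / Z * (1 - \<alpha>) + k * \<alpha>)" .
    then show ?thesis using kZ by simp
  qed
  also have "\<dots> \<le> \<eta>" using ln_mono[OF Z(2)] Z by simp
  finally have adm: "admissible \<eta> G (density G h)" by (intro admissible_density[OF G hm hb one])
  then have uH: "unit_distribution (density G h)" by (simp add: admissible_def)
  have "(p - c) * measure (density G h) {p..} \<le> (\<integral>s. m s \<partial>density G h)" by (rule price_H[OF adm])
  also have "\<dots> = (\<integral>s. h s * m s \<partial>G)"
    using hb by (subst integral_real_density) (auto cong: measurable_cong_sets)
  also have "\<dots> = (\<integral>s. h1 * m s + (h2 - h1) * (pb - c) * indicator {p..} s \<partial>G)"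
    using p pb by (intro Bochner_Integration.integral_cong)
      (auto simp: h_def m_def algebra_simps split: split_indicator)
  also have "\<dots> = h1 * (\<alpha> * r) + (h2 - h1) * (pb - c) * Y"
    using im by (simp add: ar Y_def)
  finally have "(p - c) * measure (density G h) {p..} \<le> h1 * (\<alpha> * r) + (h2 - h1) * (pb - c) * Y" .
  moreover have "measure (density G h) {p..} = h2 * Y"
  proof -
    have eq: "h s * indicator {p..} s = h2 * indicator {p..} s" for s
      using cp by (auto simp: h_def split: split_indicator)
    have "measure (density G h) {p..} = (\<integral>s. h s * indicator {p..} s \<partial>G)"
      by (rule measure_density_eq[OF uH G.unit_dist_axioms hm hb(1)]) simp
    then show ?thesis unfolding eq by (simp add: Y_def)
  qed
  ultimately have "\<sigma> * (h2 * Y) \<le> h1 * (\<alpha> * r - (pb - c) * Y)"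
    by (simp add: \<sigma>_def algebra_simps)
  \<comment> \<open>On the tail \<open>m\<close> sits at its cap \<open>pb - c\<close>, which is at
    least \<open>r\<close>, so its mean over \<open>c < s < p\<close> is at most
    \<open>r\<close>.\<close>
  also have "\<dots> \<le> h1 * (\<alpha> * (r * (1 - y)))"
  proof (intro mult_left_mono)
    have "\<alpha> * (r * y) \<le> \<alpha> * ((pb - c) * y)" using rt y al' by (intro mult_left_mono mult_right_mono) auto
    then show "\<alpha> * r - (pb - c) * Y \<le> \<alpha> * (r * (1 - y))" by (simp add: Yay algebra_simps)
  qed (use pos in simp)
  also have "\<dots> = k * \<alpha> * ((1 - x) * r)" using y by (simp add: h1_def)
  also have "\<sigma> * (h2 * Y) = k * \<alpha> * (x * \<sigma>)" using y by (simp add: h2_def Yay)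
  finally have "x * \<sigma> \<le> (1 - x) * r" using pos al' by simp
  then have "x * (r + \<sigma>) \<le> r" by (simp add: algebra_simps)
  then have "x \<le> x0" using r0 \<sigma> by (simp add: x0_def le_divide_eq)
  then show False using x by simp
qed

end

section \<open>From the tail bound to a feasible pair\<close>

context market
begin

lemma eF_excess:
  assumes "x \<in> {- c..1 - c}"
  shows "eF x = (\<integral>s. max 0 (s - (c + x)) \<partial>F)"
  using F.excess_eq[of "c + x"] assms by (simp add: eF_def mean_F)

lemma Bayes_excess_le:
  assumes "Bayes_plausible F G" "x \<in> {- c..1 - c}"
  shows "(\<integral>s. max 0 (s - (c + x)) \<partial>G) \<le> eF x"
proof -
  interpret G: unit_dist G using assms by (simp add: Bayes_plausible_def unit_distribution_iff)
  show ?thesis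
    using assms G.excess_eq[of "c + x"] by (auto simp: Bayes_plausible_def eF_def mean_F)
qed

text \<open>For a cut up to \<open>pb - c\<close>, the part of \<open>s - c\<close> below it is
  dominated by \<open>x\<close> on \<open>s > c\<close> or by the capped excess, of mean
  \<open>\<alpha> * r\<close>. For a later cut the tail bound is integrated from \<open>pb\<close>:
  the shift \<open>t = s + (r - pb)\<close> turns its argument into \<open>r / t\<close>, and
  \<open>r \<le> pb - c\<close> keeps the shifted interval inside \<open>[r, x]\<close>.\<close>

lemma surplus_le_obj:
  assumes G: "Bayes_plausible F G" and al: "1 - exp (- \<eta>) < measure G {c<..}"
    and pb: "pb \<in> {c..1}" and price: "\<And>H. admissible \<eta> G H \<Longrightarrow> seller_price c H \<le> pb"
    and r: "measure G {c<..} * r = (\<integral>s. max 0 (min (s - c) (pb - c)) \<partial>G)"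
    and x: "x \<in> {- c..1 - c}"
  shows "(\<integral>s. max 0 (s - c) \<partial>G) \<le> obj (measure G {c<..}) r x"
proof -
  have uG: "unit_distribution G" using G by (simp add: Bayes_plausible_def)
  then interpret G: unit_dist G by (simp add: unit_distribution_iff)
  define \<alpha> where "\<alpha> = measure G {c<..}"
  define m where "m s = max 0 (min (s - c) (pb - c))" for s
  have al': "1 - exp (- \<eta>) < \<alpha>" "0 < \<alpha>" "\<alpha> \<le> 1" using al alpha_pos by (auto simp: \<alpha>_def)
  have ar: "\<alpha> * r = (\<integral>s. m s \<partial>G)" using r by (simp add: \<alpha>_def m_def)
  have im: "integrable G m"
    unfolding m_def by (rule G.integrable_bounded[of _ 1]) (use pb c_pos in auto)
  have r0: "0 \<le> r"
  proof -
    have "0 \<le> \<alpha> * r" unfolding ar by (rule Bochner_Integration.integral_nonneg) (simp add: m_def)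
    then show ?thesis using al' by (simp add: zero_le_mult_iff)
  qed
  have "\<alpha> * r \<le> (\<integral>s. (pb - c) * indicator {c<..} s \<partial>G)"
    unfolding ar using im pb by (intro integral_mono) (auto simp: m_def split: split_indicator)
  then have rt: "r \<le> pb - c" using al' by (simp add: \<alpha>_def mult.commute)
  note ii = G.integrable_pos_part
  note B = Bayes_excess_le[OF G x]
  have Jn: "0 \<le> \<alpha> * integral {r..max x r} (\<lambda>t. J \<alpha> (r / t))"
    using J_integral_nonneg[OF al'(1) r0, of r] al' by simp
  consider "x \<le> r" | "r < x" "x \<le> pb - c" | "pb - c < x" by linarith
  then have "(\<integral>s. max 0 (s - c) \<partial>G) \<le> obj \<alpha> r x"
  proof cases
    case 1
    have "(\<integral>s. max 0 (s - c) \<partial>G) \<le> (\<integral>s. max 0 (s - (c + x)) + x * indicator {c<..} s \<partial>G)"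
      using ii by (intro integral_mono) (auto split: split_indicator)
    also have "\<dots> = (\<integral>s. max 0 (s - (c + x)) \<partial>G) + x * \<alpha>"
      using ii by (simp add: \<alpha>_def)
    finally show ?thesis using B 1 Jn by (simp add: obj_def min_def mult.commute)
  next
    case 2
    have "(\<integral>s. max 0 (s - c) \<partial>G) \<le> (\<integral>s. max 0 (s - (c + x)) + m s \<partial>G)"
      using ii im[unfolded m_def] 2 by (intro integral_mono) (auto simp: m_def)
    also have "\<dots> = (\<integral>s. max 0 (s - (c + x)) \<partial>G) + \<alpha> * r"
      using ii im by (simp add: ar)
    finally show ?thesis using B 2 Jn by (simp add: obj_def)
  next
    case 3
    define \<phi> where "\<phi> s = J \<alpha> (r / (s + (r - pb)))" for s
    have "(\<integral>s. max 0 (s - c) \<partial>G) = (\<integral>s. max 0 (s - pb) + m s \<partial>G)"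
      using pb by (intro Bochner_Integration.integral_cong) (auto simp: m_def)
    also have "\<dots> = (\<integral>s. max 0 (s - pb) \<partial>G) + \<alpha> * r"
      using ii im by (simp add: ar)
    finally have 1: "(\<integral>s. max 0 (s - c) \<partial>G) = (\<integral>s. max 0 (s - pb) \<partial>G) + \<alpha> * r" .
    have ci: "cdf G integrable_on {a..b}" for a b by (rule cdf_integrable) (rule G.unit_dist_axioms)
    have "integral {0..pb} (cdf G) + integral {pb..c + x} (cdf G) = integral {0..c + x} (cdf G)"
      using pb c_pos 3 ci by (intro Henstock_Kurzweil_Integration.integral_combine) auto
    then have "(\<integral>s. max 0 (s - pb) \<partial>G) = (\<integral>s. max 0 (s - (c + x)) \<partial>G) + ((c + x - pb) - integral {pb..c + x} (cdf G))"
      using G.excess_eq[of pb] G.excess_eq[of "c + x"] pb c_pos x by simp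
    also have "(c + x - pb) - integral {pb..c + x} (cdf G) = integral {pb..c + x} (\<lambda>s. 1 - cdf G s)"
      using 3 ci by (subst Henstock_Kurzweil_Integration.integral_diff) auto
    \<comment> \<open>The tail bound holds for prices strictly above \<open>pb\<close>; the value 1
      at the single point \<open>pb\<close> fills the gap.\<close>
    also have "\<dots> \<le> integral {pb..c + x} (\<lambda>s. if s = pb then 1 else \<alpha> * \<phi> s)"
    proof (rule integral_le)
      have "(\<lambda>s. J \<alpha> (r / s)) integrable_on {r..r + (c + x - pb)}" using J_integrable[OF al'(1) r0, of r] by simp
      then have "(\<lambda>s. J \<alpha> (r / (s + (r - pb)))) integrable_on {r - (r - pb)..r + (c + x - pb) - (r - pb)}"
        by (rule integrable_shift_real_ivl)
      then have "\<phi> integrable_on {pb..c + x}"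
        by (simp add: \<phi>_def[abs_def])
      then have "(\<lambda>s. \<alpha> * \<phi> s) integrable_on {pb..c + x}" using integrable_cmul[of \<phi> _ \<alpha>] by simp
      then show "(\<lambda>s. if s = pb then 1 else \<alpha> * \<phi> s) integrable_on {pb..c + x}"
        by (rule integrable_spike_finite[of "{pb}", rotated 2]) auto
      show "(\<lambda>s. 1 - cdf G s) integrable_on {pb..c + x}"
        using ci by (intro integrable_diff) auto
      fix s assume s: "s \<in> {pb..c + x}"
      show "1 - cdf G s \<le> (if s = pb then 1 else \<alpha> * \<phi> s)"
      proof (cases "s = pb")
        case True
        then show ?thesis using G.cdf_nonneg by simp
      next
        case False
        then have "measure G {s..} \<le> \<alpha> * J \<alpha> (r / (r + (s - pb)))"
          using tail_bound[OF uG al pb price r, of s] s x by (simp add: \<alpha>_def)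
        moreover have "measure G {s<..} \<le> measure G {s..}" by (intro G.finite_measure_mono) auto
        ultimately show ?thesis
          using False G.measure_greaterThan[of s] by (simp add: \<phi>_def algebra_simps)
      qed
    qed
    also have "\<dots> = integral {pb..c + x} (\<lambda>s. \<alpha> * \<phi> s)"
      by (rule integral_spike[of "{pb}"]) auto
    also have "\<dots> = \<alpha> * integral {pb..c + x} \<phi>" by simp
    also have "integral {pb..c + x} \<phi> = integral {r..r + (c + x - pb)} (\<lambda>t. J \<alpha> (r / t))"
      using integral_shift_real_ivl[of r "r - pb" "r + (c + x - pb)" "\<lambda>t. J \<alpha> (r / t)"]
      by (simp add: \<phi>_def[abs_def])
    also have "\<alpha> * integral {r..r + (c + x - pb)} (\<lambda>t. J \<alpha> (r / t)) \<le> \<alpha> * integral {r..x} (\<lambda>t. J \<alpha> (r / t))"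
    proof (intro mult_left_mono integral_subset_le)
      show "(\<lambda>t. J \<alpha> (r / t)) integrable_on {r..r + (c + x - pb)}" "(\<lambda>t. J \<alpha> (r / t)) integrable_on {r..x}"
        using J_integrable[OF al'(1) r0, of r] by auto
      show "\<forall>t\<in>{r..x}. 0 \<le> J \<alpha> (r / t)"
        using J_nonneg[OF al'(1) ratio_bounds[OF r0]] by auto
    qed (use rt al' in auto)
    finally show ?thesis using 1 3 rt B by (simp add: obj_def)
  qed
  then show ?thesis by (simp add: \<alpha>_def)
qed

text \<open>The supremum of the admissible prices need not be attained; the surplus is 1-Lipschitz
  in the price, so prices near the supremum do.\<close>

lemma surplus_lipschitz:
  assumes "unit_dist G" "a \<le> b"
  shows "(\<integral>s. max 0 (s - a) \<partial>G) \<le> (\<integral>s. max 0 (s - b) \<partial>G) + (b - a)"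
proof -
  interpret G: unit_dist G by fact
  have "(\<integral>s. max 0 (s - a) \<partial>G) \<le> (\<integral>s. max 0 (s - b) + (b - a) \<partial>G)"
    using assms G.integrable_pos_part by (intro integral_mono) auto
  also have "\<dots> = (\<integral>s. max 0 (s - b) \<partial>G) + (b - a)"
    using G.integrable_pos_part G.prob_space by simp
  finally show ?thesis .
qed

definition feasible :: "real \<Rightarrow> real \<Rightarrow> bool" where
  "feasible \<alpha> r \<longleftrightarrow> \<alpha> \<in> {0..1} \<and> 0 \<le> r \<and> max (\<mu> - c) (\<alpha> * r) \<le> \<Gamma> c \<eta> F \<alpha> r"

definition val :: "real \<Rightarrow> real \<Rightarrow> real" where
  "val \<alpha> r = \<Gamma> c \<eta> F \<alpha> r - \<alpha> * r"

text \<open>Positivity makes the pair feasible: it puts \<open>\<alpha>\<close> above the threshold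
  and \<open>\<alpha> * r\<close> below the expected excess over \<open>c\<close>, which
  \<open>\<Gamma>\<close> dominates. The bound by \<open>\<mu> - c\<close> is Jensen's inequality
  for that excess.\<close>

lemma robust_surplus_le_val:
  assumes G: "Bayes_plausible F G" and pos: "0 < robust_surplus c \<eta> G"
  shows "\<exists>\<alpha> r. feasible \<alpha> r \<and> robust_surplus c \<eta> G \<le> val \<alpha> r"
proof -
  have uG: "unit_distribution G" using G by (simp add: Bayes_plausible_def)
  then interpret G: unit_dist G by (simp add: unit_distribution_iff)
  define \<alpha> where "\<alpha> = measure G {c<..}"
  have al: "1 - exp (- \<eta>) < measure G {c<..}"
    using no_surplus_if_rarely_above_cost[OF uG] pos by (auto simp: not_le[symmetric])
  have al': "1 - exp (- \<eta>) < \<alpha>" "0 < \<alpha>" "\<alpha> \<le> 1" using al alpha_pos by (auto simp: \<alpha>_def)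
  define P where "P = seller_price c ` {H. admissible \<eta> G H}"
  have mem: "P \<subseteq> {c..1}"
  proof
    fix p assume "p \<in> P"
    then obtain H where H: "p = seller_price c H" "unit_distribution H" by (auto simp: P_def admissible_def)
    then interpret H: unit_dist H by (simp add: unit_distribution_iff)
    show "p \<in> {c..1}" using H.seller_price_mem c_pos c_le H by simp
  qed
  have Pne: "P \<noteq> {}" using admissible_self[OF uG eta_nonneg] by (auto simp: P_def)
  have bdd: "bdd_above P" by (rule bdd_above_mono[OF _ mem]) simp
  define pb where "pb = Sup P"
  have upper: "p \<le> pb" if "p \<in> P" for p using that bdd by (auto simp: pb_def intro: cSup_upper)
  have pb: "pb \<in> {c..1}"
    using mem Pne upper cSup_least[OF Pne, of 1] by (fastforce simp: pb_def)
  have price: "seller_price c H \<le> pb" if "admissible \<eta> G H" for H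
    using upper that by (auto simp: P_def)
  define r where "r = (\<integral>s. max 0 (min (s - c) (pb - c)) \<partial>G) / \<alpha>"
  have r: "measure G {c<..} * r = (\<integral>s. max 0 (min (s - c) (pb - c)) \<partial>G)"
    using al' by (simp add: r_def \<alpha>_def)
  have r0: "0 \<le> r" unfolding r_def using al' by (intro divide_nonneg_pos Bochner_Integration.integral_nonneg) auto
  have "robust_surplus c \<eta> G \<le> (\<integral>s. max 0 (s - pb) \<partial>G)"
  proof (rule field_le_epsilon)
    fix e :: real assume "0 < e"
    then obtain p where "p \<in> P" "pb - e < p" unfolding pb_def using less_cSupD[OF Pne, of "Sup P - e"] by auto
    then obtain H where H: "admissible \<eta> G H" "pb - e < seller_price c H" by (auto simp: P_def)
    have "robust_surplus c \<eta> G \<le> (\<integral>s. max 0 (s - seller_price c H) \<partial>G)" by (rule robust_surplus_le[OF uG H(1)])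
    also have "\<dots> \<le> (\<integral>s. max 0 (s - pb) \<partial>G) + (pb - seller_price c H)"
      by (rule surplus_lipschitz[OF G.unit_dist_axioms price[OF H(1)]])
    finally show "robust_surplus c \<eta> G \<le> (\<integral>s. max 0 (s - pb) \<partial>G) + e" using H by simp
  qed
  also have "\<dots> = (\<integral>s. max 0 (s - c) - max 0 (min (s - c) (pb - c)) \<partial>G)"
    using pb by (intro Bochner_Integration.integral_cong) auto
  also have "\<dots> = (\<integral>s. max 0 (s - c) \<partial>G) - \<alpha> * r"
  proof -
    have "integrable G (\<lambda>s. max 0 (min (s - c) (pb - c)))"
      by (rule G.integrable_bounded[of _ 1]) (use pb c_pos in auto)
    then show ?thesis using G.integrable_pos_part r by (simp add: \<alpha>_def)
  qed
  finally have w: "robust_surplus c \<eta> G \<le> (\<integral>s. max 0 (s - c) \<partial>G) - \<alpha> * r" .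
  have Gam: "(\<integral>s. max 0 (s - c) \<partial>G) \<le> \<Gamma> c \<eta> F \<alpha> r"
    using surplus_le_obj[OF G al pb price r] by (intro le_Gamma[OF al'(1)]) (auto simp: \<alpha>_def)
  have "\<mu> - c \<le> (\<integral>s. max 0 (s - c) \<partial>G)"
    using G.excess_eq[of c] cdf_integral_nonneg[OF G.unit_dist_axioms, of 0 c] c_pos G
    by (simp add: Bayes_plausible_def mean_F)
  then have "feasible \<alpha> r" using w Gam pos r0 al' by (simp add: feasible_def)
  moreover have "robust_surplus c \<eta> G \<le> val \<alpha> r" using w Gam by (simp add: val_def)
  ultimately show ?thesis by blast
qed

end

section \<open>Pairs of positive value: a priori bounds and continuity\<close>

context market
begin

lemma eF_nonneg: "x \<in> {- c..1 - c} \<Longrightarrow> 0 \<le> eF x"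
  by (simp add: eF_excess)

lemma eF_antimono:
  assumes "x \<in> {- c..1 - c}" "y \<in> {- c..1 - c}" "x \<le> y"
  shows "eF y \<le> eF x"
  unfolding eF_excess[OF assms(1)] eF_excess[OF assms(2)]
  using F.integrable_pos_part assms(3) by (intro integral_mono) auto

lemma eF_end: "eF (1 - c) = 0"
proof -
  have "(\<integral>s. max 0 (s - 1) \<partial>F) = (\<integral>s. 0 \<partial>F)"
  proof (rule integral_cong_AE)
    show "AE s in F. max 0 (s - 1) = 0" using F.AE_unit by eventually_elim auto
  qed auto
  then show ?thesis using eF_excess[of "1 - c"] c_pos c_le by simp
qed

text \<open>The tail function is largest at 1, where it is
  \<open>exp (- eta_adj \<eta> \<alpha>)\<close>. Through this estimate a positive value keeps
  \<open>\<alpha>\<close> away from the threshold quantitatively.\<close>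

lemma alpha_J_le:
  assumes "1 - exp (- \<eta>) < \<alpha>" "0 \<le> x" "x \<le> 1"
  shows "\<alpha> * J \<alpha> x \<le> exp (- \<eta>) - 1 + \<alpha>"
proof -
  have "\<alpha> * J \<alpha> x \<le> \<alpha> * J \<alpha> 1"
    using assms alpha_pos[OF assms(1)] by (intro mult_left_mono J_mono) auto
  then show ?thesis using exp_eta_adj[OF assms(1)] by (simp add: J_def I_inv_1)
qed

text \<open>Everything is read off at \<open>x = 1 - c\<close>, where \<open>eF\<close> vanishes and
  only the price term and the tail integral remain.\<close>

lemma feasible_pos_val:
  assumes "feasible \<alpha> r" "0 < val \<alpha> r"
  shows "1 - exp (- \<eta>) < \<alpha>" "0 < r" "r \<le> 1 - c" "r < 1 - c" "val \<alpha> r \<le> exp (- \<eta>) - 1 + \<alpha>"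
    "val \<alpha> r \<le> \<alpha> * integral {r..1 - c} (\<lambda>t. J \<alpha> (r / t))"
proof -
  have f: "0 \<le> \<alpha>" "\<alpha> \<le> 1" "0 \<le> r" using assms by (auto simp: feasible_def)
  show al: "1 - exp (- \<eta>) < \<alpha>"
  proof (rule ccontr)
    assume "\<not> ?thesis"
    then have "\<Gamma> c \<eta> F \<alpha> r = 0" by (simp add: \<Gamma>_def)
    then show False using assms(2) f mult_nonneg_nonneg[OF f(1,3)] by (simp add: val_def)
  qed
  note ap = alpha_pos[OF al]
  have G: "\<Gamma> c \<eta> F \<alpha> r \<le> obj \<alpha> r (1 - c)"
    using f c_pos c_le by (intro Gamma_le_obj[OF al]) auto
  show rc: "r \<le> 1 - c"
  proof (rule ccontr)
    assume n: "\<not> r \<le> 1 - c"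
    then have "obj \<alpha> r (1 - c) = \<alpha> * (1 - c)" by (simp add: obj_def eF_end)
    moreover have "\<alpha> * (1 - c) < \<alpha> * r" using n ap by simp
    ultimately show False using G assms(2) by (simp add: val_def)
  qed
  then show v: "val \<alpha> r \<le> \<alpha> * integral {r..1 - c} (\<lambda>t. J \<alpha> (r / t))"
    using G by (simp add: val_def obj_def eF_end)
  show "r < 1 - c"
  proof (rule ccontr)
    assume "\<not> ?thesis"
    then have "r = 1 - c" using rc by simp
    then show False using v assms(2) by simp
  qed
  show "0 < r"
  proof (rule ccontr)
    assume "\<not> ?thesis"
    then have "r = 0" using f by simp
    then show False using v assms(2) by simp
  qed
  have "\<alpha> * integral {r..1 - c} (\<lambda>t. J \<alpha> (r / t)) = integral {r..1 - c} (\<lambda>t. \<alpha> * J \<alpha> (r / t))"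
    by simp
  also have "\<dots> \<le> integral {r..1 - c} (\<lambda>t. exp (- \<eta>) - 1 + \<alpha>)"
  proof (rule integral_le)
    show "(\<lambda>t. \<alpha> * J \<alpha> (r / t)) integrable_on {r..1 - c}"
      using integrable_cmul[OF J_integrable[OF al f(3)], of r \<alpha>] by simp
    show "\<alpha> * J \<alpha> (r / t) \<le> exp (- \<eta>) - 1 + \<alpha>" if "t \<in> {r..1 - c}" for t
      using that ratio_bounds[OF f(3)] by (intro alpha_J_le[OF al]) auto
  qed auto
  also have "\<dots> = (1 - c - r) * (exp (- \<eta>) - 1 + \<alpha>)" using rc by simp
  also have "\<dots> \<le> 1 * (exp (- \<eta>) - 1 + \<alpha>)"
    using al f c_pos by (intro mult_right_mono) auto
  finally show "val \<alpha> r \<le> exp (- \<eta>) - 1 + \<alpha>" using v by simp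
qed

text \<open>Dominated convergence wants a domain that does not move with \<open>r\<close>. The point
  \<open>a\<close> will be the limit of the values of \<open>r\<close>, the one place where the
  cut-off integrands may fail to converge.\<close>

lemma J_integral_cut:
  assumes al: "1 - exp (- \<eta>) < \<alpha>" and r: "0 \<le> r" and x: "x \<le> 1"
  shows "(\<lambda>t. if r < t \<and> t \<le> x \<and> t \<noteq> a then J \<alpha> (r / t) else 0) integrable_on {0..1}"
    and "integral {0..1} (\<lambda>t. if r < t \<and> t \<le> x \<and> t \<noteq> a then J \<alpha> (r / t) else 0) =
      integral {r..max x r} (\<lambda>t. J \<alpha> (r / t))"
proof -
  let ?f = "\<lambda>t. J \<alpha> (r / t)"
  let ?g = "\<lambda>t. if t \<in> {r..x} then ?f t else 0"
  let ?h = "\<lambda>t. if r < t \<and> t \<le> x \<and> t \<noteq> a then ?f t else 0"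
  have sub: "{r..x} \<inter> {0..1} = {r..x}" using r x by auto
  have "?g integrable_on {0..1}"
    unfolding integrable_restrict_Int sub using J_integrable[OF al r] by simp
  then show "?h integrable_on {0..1}"
    by (rule integrable_spike_finite[of "{a, r}", rotated 2]) auto
  have "integral {0..1} ?h = integral {0..1} ?g"
    by (rule integral_spike[of "{a, r}"]) auto
  also have "\<dots> = integral {r..x} ?f"
    unfolding integral_restrict_Int sub ..
  also have "\<dots> = integral {r..max x r} ?f"
    by (cases "r \<le> x") (auto simp: max_def)
  finally show "integral {0..1} ?h = integral {r..max x r} ?f" .
qed

lemma tendsto_eta_adj:
  assumes "A \<longlonglongrightarrow> \<alpha>" "1 - exp (- \<eta>) < \<alpha>"
  shows "(\<lambda>n. eta_adj \<eta> (A n)) \<longlonglongrightarrow> eta_adj \<eta> \<alpha>"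
  unfolding eta_adj_def using assms alpha_pos[OF assms(2)]
  by (intro tendsto_intros) auto

lemma tendsto_obj:
  assumes A: "A \<longlonglongrightarrow> \<alpha>" "\<And>n. 1 - exp (- \<eta>) < A n" "1 - exp (- \<eta>) < \<alpha>"
    and R: "R \<longlonglongrightarrow> r" "\<And>n. 0 \<le> R n" and x: "x \<le> 1"
  shows "(\<lambda>n. obj (A n) (R n) x) \<longlonglongrightarrow> obj \<alpha> r x"
proof -
  have r: "0 \<le> r" using R LIMSEQ_le_const by fastforce
  let ?g = "\<lambda>\<alpha> s t. if s < t \<and> t \<le> x \<and> t \<noteq> r then J \<alpha> (s / t) else 0"
  have "(\<lambda>n. integral {0..1} (?g (A n) (R n))) \<longlonglongrightarrow> integral {0..1} (?g \<alpha> r)"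
  proof (rule dominated_convergence(2)[where h = "\<lambda>_. 1"])
    show "?g (A n) (R n) integrable_on {0..1}" for n
      by (rule J_integral_cut(1)[OF A(2) R(2) x])
    show "norm (?g (A n) (R n) t) \<le> 1" if "t \<in> {0..1}" for n t
    proof (cases "R n < t")
      case True
      then show ?thesis
        using J_bounds[OF A(2) ratio_bounds[OF R(2), of n t], of n] ratio_bounds[OF R(2), of n t] by auto
    qed simp
    show "(\<lambda>n. ?g (A n) (R n) t) \<longlonglongrightarrow> ?g \<alpha> r t" if "t \<in> {0..1}" for t
    proof -
      consider "x < t \<or> t = r" | "t < r" | "r < t" "t \<le> x" by fastforce
      then show ?thesis
      proof cases
        case 1
        then have "?g (A n) (R n) t = 0" for n by auto
        moreover have "?g \<alpha> r t = 0" using 1 by auto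
        ultimately show ?thesis by (simp only: tendsto_const)
      next
        case 2
        have "eventually (\<lambda>n. t < R n) sequentially" using order_tendstoD(1)[OF R(1) 2] .
        then have "eventually (\<lambda>n. ?g (A n) (R n) t = ?g \<alpha> r t) sequentially"
          by eventually_elim (use 2 in auto)
        then show ?thesis by (rule tendsto_eventually)
      next
        case 3
        have ev: "eventually (\<lambda>n. R n < t) sequentially" using order_tendstoD(2)[OF R(1) 3(1)] .
        \<comment> \<open>For finitely many \<open>n\<close> the ratio may exceed 1; truncating it
          meets the hypotheses of \<open>tendsto_I_inv\<close> for every \<open>n\<close>.\<close>
        have "(\<lambda>n. I_inv (ereal (eta_adj \<eta> (A n))) (min 1 (R n / t))) \<longlonglongrightarrow> I_inv (ereal (eta_adj \<eta> \<alpha>)) (r / t)"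
        proof (rule tendsto_I_inv)
          have "(\<lambda>n. min 1 (R n / t)) \<longlonglongrightarrow> min 1 (r / t)"
            using R 3 r by (intro tendsto_intros) auto
          then show "(\<lambda>n. min 1 (R n / t)) \<longlonglongrightarrow> r / t" using ratio_bounds[OF r, of t] 3 by (simp add: min_def split: if_splits)
          show "(\<lambda>n. eta_adj \<eta> (A n)) \<longlonglongrightarrow> eta_adj \<eta> \<alpha>" by (rule tendsto_eta_adj[OF A(1,3)])
          show "0 \<le> r / t" "r / t \<le> 1" using ratio_bounds[OF r, of t] 3 by auto
          show "0 \<le> min 1 (R n / t)" for n using R(2)[of n] 3 r by simp
        qed (use eta_adj_nonneg A in auto)
        moreover have "eventually (\<lambda>n. I_inv (ereal (eta_adj \<eta> (A n))) (min 1 (R n / t)) = ?g (A n) (R n) t) sequentially"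
          using ev
        proof eventually_elim
          case (elim n)
          then show ?case using 3 ratio_bounds[OF R(2), of n t] by (simp add: J_def min_def)
        qed
        ultimately show ?thesis using 3 by (simp add: J_def tendsto_cong)
      qed
    qed
  qed (rule integrable_const_ivl)
  then have "(\<lambda>n. integral {R n..max x (R n)} (\<lambda>t. J (A n) (R n / t))) \<longlonglongrightarrow> integral {r..max x r} (\<lambda>t. J \<alpha> (r / t))"
    by (simp only: J_integral_cut(2)[OF A(2) R(2) x] J_integral_cut(2)[OF A(3) r x])
  then show ?thesis unfolding obj_def by (intro tendsto_intros A R)
qed

subsection \<open>The finite-dimensional problem\<close>

lemma val_attained:
  assumes "feasible \<alpha>0 r0" "0 < val \<alpha>0 r0"
  shows "\<exists>\<alpha> r. feasible \<alpha> r \<and> 0 < val \<alpha> r \<and> (\<forall>\<alpha>' r'. feasible \<alpha>' r' \<longrightarrow> val \<alpha>' r' \<le> val \<alpha> r)"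
proof -
  define V where "V = {val \<alpha> r |\<alpha> r. feasible \<alpha> r}"
  define S where "S = Sup V"
  have le1: "val \<alpha> r \<le> 1" if "feasible \<alpha> r" for \<alpha> r

  proof (cases "0 < val \<alpha> r")
    case True
    then have "val \<alpha> r \<le> exp (- \<eta>) - 1 + \<alpha>" by (rule feasible_pos_val(5)[OF that])
    moreover have "\<alpha> \<le> 1" using that by (simp add: feasible_def)
    ultimately show ?thesis using exp_eta_le_1 by linarith
  qed simp
  have bdd: "bdd_above V" using le1 by (auto simp: V_def intro!: bdd_aboveI[of _ 1])
  have le_S: "val \<alpha> r \<le> S" if "feasible \<alpha> r" for \<alpha> r
    unfolding S_def using that bdd by (intro cSup_upper) (auto simp: V_def)
  have S: "0 < S" using le_S[OF assms(1)] assms(2) by simp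
  have ne: "V \<noteq> {}" using assms by (auto simp: V_def)
  \<comment> \<open>The bound \<open>S / 2\<close> keeps \<open>\<alpha>\<close> at distance at
    least \<open>S / 2\<close> from the threshold, where \<open>\<Gamma>\<close> is cut to 0 and
    \<open>eta_adj\<close> blows up; the other bound makes the sequence maximising.\<close>
  have "\<exists>\<alpha> r. feasible \<alpha> r \<and> max (S / 2) (S - inverse (real (Suc n))) < val \<alpha> r" for n
  proof -
    have "max (S / 2) (S - inverse (real (Suc n))) < Sup V" using S by (simp add: S_def[symmetric])
    from less_cSupD[OF ne this] show ?thesis by (auto simp: V_def)
  qed
  then obtain A R where AR: "\<And>n. feasible (A n) (R n)" "\<And>n. max (S / 2) (S - inverse (real (Suc n))) < val (A n) (R n)"
    by metis
  have pos: "0 < val (A n) (R n)" for n using AR(2)[of n] S by simp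
  note fp = feasible_pos_val[OF AR(1) pos]
  have sc: "seq_compact ({0..1::real} \<times> {0..1::real})"
    by (intro compact_imp_seq_compact compact_Times) auto
  have "(A n, R n) \<in> {0..1} \<times> {0..1}" for n
    using AR(1)[of n] fp(3)[of n] c_pos by (auto simp: feasible_def)
  then obtain l \<phi> where l: "strict_mono \<phi>" "((\<lambda>n. (A n, R n)) \<circ> \<phi>) \<longlonglongrightarrow> l"
    by (rule seq_compactE[OF sc allI])
  define \<alpha> r where "\<alpha> = fst l" and "r = snd l"
  have lA: "(\<lambda>n. A (\<phi> n)) \<longlonglongrightarrow> \<alpha>" and lR: "(\<lambda>n. R (\<phi> n)) \<longlonglongrightarrow> r"
    using tendsto_fst[OF l(2)] tendsto_snd[OF l(2)] by (auto simp: o_def \<alpha>_def r_def)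
  have "1 - exp (- \<eta>) + S / 2 \<le> A n" for n using fp(5)[of n] AR(2)[of n] by simp
  then have "1 - exp (- \<eta>) + S / 2 \<le> \<alpha>" using lA LIMSEQ_le_const by blast
  then have al: "1 - exp (- \<eta>) < \<alpha>" using S by simp
  have al1: "\<alpha> \<le> 1" using lA AR(1) LIMSEQ_le_const2[OF lA, of 1] by (auto simp: feasible_def)
  have r: "0 \<le> r" using LIMSEQ_le_const[OF lR, of 0] fp(2) by (auto intro: less_imp_le)
  have lv: "(\<lambda>n. val (A (\<phi> n)) (R (\<phi> n))) \<longlonglongrightarrow> S"
  proof (rule tendsto_sandwich)
    show "eventually (\<lambda>n. S - inverse (real (Suc (\<phi> n))) \<le> val (A (\<phi> n)) (R (\<phi> n))) sequentially"
      using AR(2) by (intro always_eventually allI) (meson less_imp_le max_less_iff_conj)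
    show "eventually (\<lambda>n. val (A (\<phi> n)) (R (\<phi> n)) \<le> S) sequentially"
      using le_S AR(1) by (intro always_eventually) auto
    have "(\<lambda>n. S - inverse (real (Suc (\<phi> n)))) \<longlonglongrightarrow> S - 0"
      using LIMSEQ_subseq_LIMSEQ[OF LIMSEQ_inverse_real_of_nat l(1)]
      by (intro tendsto_diff tendsto_const) (simp add: o_def)
    then show "(\<lambda>n. S - inverse (real (Suc (\<phi> n)))) \<longlonglongrightarrow> S" by simp
  qed simp
  have lG: "(\<lambda>n. \<Gamma> c \<eta> F (A (\<phi> n)) (R (\<phi> n))) \<longlonglongrightarrow> S + \<alpha> * r"
    using tendsto_add[OF lv tendsto_mult[OF lA lR]] by (simp add: val_def)
  \<comment> \<open>For each fixed \<open>x\<close> the bounds pass to the limit; taking the infimum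
    over \<open>x\<close> afterwards gives upper semicontinuity and both constraints at
    once.\<close>
  have ge: "max (\<mu> - c) (S + \<alpha> * r) \<le> obj \<alpha> r x" if x: "x \<in> {- c..1 - c}" for x
  proof -
    have lo: "(\<lambda>n. obj (A (\<phi> n)) (R (\<phi> n)) x) \<longlonglongrightarrow> obj \<alpha> r x"
      by (intro tendsto_obj[OF lA fp(1) al lR] less_imp_le[OF fp(2)]) (use x c_pos in auto)
    have Go: "\<Gamma> c \<eta> F (A n) (R n) \<le> obj (A n) (R n) x" for n
      using AR(1)[of n] by (intro Gamma_le_obj[OF fp(1) _ _ x]) (auto simp: feasible_def)
    have "S + \<alpha> * r \<le> obj \<alpha> r x" by (rule LIMSEQ_le[OF lG lo]) (use Go in auto)
    moreover have "\<mu> - c \<le> obj (A n) (R n) x" for n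
      using Go[of n] AR(1)[of n] by (auto simp: feasible_def)
    then have "\<mu> - c \<le> obj \<alpha> r x" using LIMSEQ_le_const[OF lo] by blast
    ultimately show ?thesis by simp
  qed
  have "max (\<mu> - c) (S + \<alpha> * r) \<le> \<Gamma> c \<eta> F \<alpha> r" by (rule le_Gamma[OF al ge])
  then have "feasible \<alpha> r" "S \<le> val \<alpha> r"
    using al1 alpha_pos[OF al] r S by (auto simp: feasible_def val_def)
  then show ?thesis using le_S S by (intro exI[of _ \<alpha>] exI[of _ r]) force
qed

end

section \<open>Which costs admit a pair of positive value\<close>

locale regular_market = market +
  assumes cont: "continuous_on UNIV (cdf F)" and supp: "dist_support F = {0..1}"
begin

lemma isCont_cdf_F: "isCont (cdf F) x"
  using cont by (simp add: continuous_on_eq_continuous_at)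

lemma no_atoms: "measure F {x} = 0"
  using isCont_cdf_F F.isCont_cdf by simp

lemma measure_open_pos: "open U \<Longrightarrow> x \<in> U \<Longrightarrow> 0 \<le> x \<Longrightarrow> x \<le> 1 \<Longrightarrow> 0 < measure F U"
  using supp by (auto simp: dist_support_def set_eq_iff)

lemma cdf_1: "cdf F 1 = 1"
proof -
  have "measure F {0..1} \<le> cdf F 1" unfolding cdf_def by (intro F.finite_measure_mono) auto
  then show ?thesis using F.measure_unit_interval F.cdf_bounded_prob[of 1] by simp
qed

lemma cdf_0: "cdf F 0 = 0"
proof -
  have "AE s in F. s \<notin> {..<0}" using F.AE_unit by eventually_elim auto
  then have "measure F {..<0} = 0" by (subst F.prob_eq_0) auto
  moreover have "measure F {..0} = measure F {..<0} + measure F {0}"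
    by (subst F.finite_measure_Union[symmetric]) (auto intro!: arg_cong[where f = "measure F"])
  ultimately show ?thesis by (simp add: cdf_def no_atoms)
qed

lemma eF_pos:
  assumes "x \<in> {- c..<1 - c}"
  shows "0 < eF x"
proof -
  define a where "a = c + x"
  define b where "b = (a + 1) / 2"
  have ab: "0 \<le> a" "a < b" "b < 1" using assms by (auto simp: a_def b_def)
  have "0 < (b - a) * measure F {b<..}"
    using ab measure_open_pos[of "{b<..}" 1] by simp
  also have "\<dots> = (\<integral>s. (b - a) * indicator {b<..} s \<partial>F)" by simp
  also have "\<dots> \<le> (\<integral>s. max 0 (s - a) \<partial>F)"
    using ab F.integrable_pos_part by (intro integral_mono) (auto split: split_indicator)
  finally show ?thesis using eF_excess[of x] assms by (simp add: a_def)
qed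

text \<open>A line of slope \<open>- \<alpha>\<close> below \<open>eF\<close> gives
  \<open>\<Gamma>\<close> at least \<open>M\<close> for \<open>r = M / \<alpha>\<close>, but with no
  value left over. Lowering \<open>r\<close> slightly creates value: the loss for
  \<open>x > r\<close> is covered by the slack of \<open>eF\<close> or by the tail integral.\<close>

lemma ex_pos_val_if_line:
  assumes al: "1 - exp (- \<eta>) < \<alpha>" "\<alpha> \<le> 1" and c1: "c < 1"
    and M: "0 < M" "\<mu> - c \<le> M" and line: "\<And>x. x \<in> {- c..1 - c} \<Longrightarrow> M \<le> \<alpha> * x + eF x"
  shows "\<exists>\<alpha> r. feasible \<alpha> r \<and> 0 < val \<alpha> r"
proof -
  note ap = alpha_pos[OF al(1)]
  define R where "R = M / \<alpha>"
  have MR: "M = \<alpha> * R" using ap by (simp add: R_def)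
  have R0: "0 < R" using ap M by (simp add: R_def)
  have "\<alpha> * R \<le> \<alpha> * (1 - c)" using line[of "1 - c"] c_pos c1 by (simp add: eF_end MR)
  then have "R \<le> 1 - c" using ap by simp
  \<comment> \<open>Otherwise the line meets \<open>eF\<close> at the top of the support. But
    \<open>eF (y - c)\<close> is at most \<open>(1 - y) * (1 - cdf F y)\<close>, of smaller order
    than \<open>\<alpha> * (1 - y)\<close> because the CDF is continuous at 1.\<close>
  moreover have "R \<noteq> 1 - c"
  proof
    assume Rc: "R = 1 - c"
    have "eventually (\<lambda>y. 1 - \<alpha> < cdf F y) (at 1)"
      using order_tendstoD(1)[OF isContD[OF isCont_cdf_F, of 1], of "1 - \<alpha>"] ap by (simp add: cdf_1)
    then obtain d where d: "0 < d" "\<And>y. y \<noteq> 1 \<Longrightarrow> dist y 1 < d \<Longrightarrow> 1 - \<alpha> < cdf F y"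
      unfolding eventually_at by auto
    define y where "y = 1 - min d 1 / 2"
    have y: "0 < y" "y < 1" "1 - \<alpha> < cdf F y"
      using d(1) d(2)[of y] by (auto simp: y_def dist_real_def)
    have yx: "y - c \<in> {- c..1 - c}" using y by simp
    have "\<alpha> * (1 - y) \<le> eF (y - c)" using line[OF yx] by (simp add: MR Rc algebra_simps)
    also have "\<dots> = (\<integral>s. max 0 (s - y) \<partial>F)" using eF_excess[OF yx] by simp
    also have "\<dots> \<le> (\<integral>s. (1 - y) * indicator {y<..} s \<partial>F)"
    proof (rule integral_mono_AE)
      show "AE s in F. max 0 (s - y) \<le> (1 - y) * indicator {y<..} s"
        using F.AE_unit by eventually_elim (auto split: split_indicator)
    qed (use F.integrable_pos_part in auto)
    also have "\<dots> = (1 - y) * (1 - cdf F y)" using F.measure_greaterThan[of y] by simp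
    finally have "(1 - y) * \<alpha> \<le> (1 - y) * (1 - cdf F y)" by (simp add: mult.commute)
    then show False using y by simp
  qed
  ultimately have R1: "R < 1 - c" by simp
  define x1 where "x1 = (R + (1 - c)) / 2"
  have x1: "R < x1" "x1 < 1 - c" using R1 by (auto simp: x1_def)
  \<comment> \<open>\<open>e1\<close> pays for lowering \<open>R\<close> to \<open>r\<close> at cuts
    up to \<open>x1\<close>. Beyond \<open>x1\<close> it is \<open>e2\<close>, a lower bound on the
    tail integral over \<open>[r, x1]\<close> that is uniform in \<open>r\<close> between
    \<open>R / 2\<close> and \<open>R\<close>.\<close>
  define e1 where "e1 = eF x1"
  define e2 where "e2 = \<alpha> * ((x1 - R) * J \<alpha> (R / 2 / x1))"
  have e1: "0 < e1" unfolding e1_def using x1 R0 c_pos by (intro eF_pos) auto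
  have e2: "0 < e2"
    unfolding e2_def J_def using x1 R0 ap eta_adj_nonneg[OF al(1)]
    by (intro mult_pos_pos I_inv_bounds) (auto simp: divide_le_eq)
  define r where "r = max (R / 2) (R - min e1 e2 / \<alpha>)"
  have r: "R / 2 \<le> r" "r < R" "0 \<le> r" using R0 e1 e2 ap by (auto simp: r_def)
  have gap: "\<alpha> * (R - r) \<le> min e1 e2"
  proof -
    have "R - r \<le> min e1 e2 / \<alpha>" by (auto simp: r_def)
    then show ?thesis using ap by (simp add: le_divide_eq mult.commute)
  qed
  have "M \<le> \<Gamma> c \<eta> F \<alpha> r"
  proof (rule le_Gamma[OF al(1)])
    fix x assume x: "x \<in> {- c..1 - c}"
    have Jn: "0 \<le> \<alpha> * integral {r..max x r} (\<lambda>t. J \<alpha> (r / t))"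
      using J_integral_nonneg[OF al(1) r(3), of r] ap by simp
    consider "x \<le> r" | "r < x" "x \<le> x1" | "x1 < x" by linarith
    then show "M \<le> obj \<alpha> r x"
    proof cases
      case 1
      then show ?thesis using line[OF x] by (simp add: obj_def)
    next
      case 2
      have "e1 \<le> eF x" unfolding e1_def using x x1 R0 c_pos 2 by (intro eF_antimono) auto
      then show ?thesis using gap Jn 2 by (simp add: obj_def MR algebra_simps)
    next
      case 3
      have "e2 \<le> \<alpha> * integral {r..x1} (\<lambda>t. J \<alpha> (R / 2 / x1))"
        unfolding e2_def using ap x1 r R0 J_nonneg[OF al(1), of "R / 2 / x1"]
        by (auto intro!: mult_left_mono mult_right_mono simp: divide_le_eq)
      also have "\<dots> \<le> \<alpha> * integral {r..x1} (\<lambda>t. J \<alpha> (r / t))"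
      proof (intro mult_left_mono integral_le)
        show "(\<lambda>t. J \<alpha> (r / t)) integrable_on {r..x1}" using J_integrable[OF al(1) r(3)] by simp
        fix t assume t: "t \<in> {r..x1}"
        have "R / 2 / x1 \<le> r / t" using t r R0 x1 by (intro frac_le) auto
        then show "J \<alpha> (R / 2 / x1) \<le> J \<alpha> (r / t)"
          using t r R0 x1 ratio_bounds[OF r(3), of t] by (intro J_mono[OF al(1)]) auto
      qed (use ap in auto)
      also have "\<dots> \<le> \<alpha> * integral {r..x} (\<lambda>t. J \<alpha> (r / t))"
      proof (intro mult_left_mono integral_subset_le)
        show "\<forall>t\<in>{r..x}. 0 \<le> J \<alpha> (r / t)"
          using J_nonneg[OF al(1) ratio_bounds[OF r(3)]] by auto
      qed (use ap J_integrable[OF al(1) r(3)] 3 in auto)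
      finally show ?thesis using gap 3 x1 r eF_nonneg[OF x] by (simp add: obj_def MR algebra_simps)
    qed
  qed
  moreover have "\<alpha> * r < M" using r ap by (simp add: MR)
  ultimately have "feasible \<alpha> r" "0 < val \<alpha> r" using M al ap r by (auto simp: feasible_def val_def)
  then show ?thesis by blast
qed

text \<open>Full support makes the CDF injective on the unit interval, so
  \<open>the_inv_into\<close> yields a genuine quantile; without atoms the mass from it upwards is
  exact.\<close>

lemma quantile:
  assumes "0 < \<eta>"
  defines "q \<equiv> the_inv_into {0..1} (cdf F) (exp (- \<eta>))"
  shows "0 \<le> q" "q \<le> 1" "measure F {q..} = 1 - exp (- \<eta>)"
proof -
  have inj: "inj_on (cdf F) {0..1}"
  proof (rule linorder_inj_onI)
    fix x y :: real assume xy: "x < y" "x \<in> {0..1}" "y \<in> {0..1}"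
    have "0 < measure F {x<..<y}" by (rule measure_open_pos[of _ "(x + y) / 2"]) (use xy in auto)
    also have "\<dots> \<le> measure F {x<..y}" by (intro F.finite_measure_mono) auto
    also have "\<dots> = cdf F y - cdf F x" using F.cdf_diff_eq[OF xy(1)] by simp
    finally show "cdf F x \<noteq> cdf F y" by simp
  qed auto
  have "\<exists>x\<ge>0. x \<le> 1 \<and> cdf F x = exp (- \<eta>)"
    using assms by (intro IVT') (auto simp: cdf_0 cdf_1 intro: continuous_on_subset[OF cont])
  then have im: "exp (- \<eta>) \<in> cdf F ` {0..1}" by force
  have qm: "q \<in> {0..1}" unfolding q_def by (rule the_inv_into_into[OF inj im]) simp
  then show "0 \<le> q" "q \<le> 1" by auto
  have "cdf F q = exp (- \<eta>)" unfolding q_def by (rule f_the_inv_into_f[OF inj im])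
  moreover have "measure F {..q} = measure F {..<q} + measure F {q}"
    by (subst F.finite_measure_Union[symmetric]) (auto intro!: arg_cong[where f = "measure F"])
  ultimately show "measure F {q..} = 1 - exp (- \<eta>)"
    by (simp add: F.measure_atLeast cdf_def no_atoms)
qed

lemma c_bar_eq:
  assumes "0 < \<eta>"
  defines "q \<equiv> the_inv_into {0..1} (cdf F) (exp (- \<eta>))"
  shows "(1 - exp (- \<eta>)) * c_bar \<eta> F = (\<integral>s. s * indicator {q..} s \<partial>F)"
proof -
  have set: "{v. q \<le> v} = {q..}" by auto
  have m: "measure F {q..} = 1 - exp (- \<eta>)" using quantile(3)[OF assms(1)] by (simp add: q_def)
  have d: "0 < 1 - exp (- \<eta>)" using assms by simp
  have "uniform_measure F {q..} = density F (\<lambda>s. ennreal (indicator {q..} s / measure F {q..}))"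
    unfolding uniform_measure_def
    by (intro density_cong)
      (use divide_ennreal[of 1 "1 - exp (- \<eta>)"] d in \<open>auto simp: F.emeasure_eq_measure m split: split_indicator\<close>)
  then have "c_bar \<eta> F = (\<integral>s. indicator {q..} s / measure F {q..} * s \<partial>F)"
    unfolding c_bar_def q_def[symmetric] set using assms(1)
    by (simp add: integral_real_density)
  also have "\<dots> = (\<integral>s. s * indicator {q..} s / (1 - exp (- \<eta>)) \<partial>F)"
    by (simp add: m mult.commute)
  also have "\<dots> = (\<integral>s. s * indicator {q..} s \<partial>F) / (1 - exp (- \<eta>))" by simp
  finally show ?thesis using d by simp
qed

text \<open>The pointwise bound of \<open>(s - a) * indicator {q..} s\<close> by (s - a)^+ is an
  equality at \<open>a = q\<close>. Thus a line of slope \<open>- (1 - exp (- \<eta>))\<close>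
  supports the expected excess at the quantile.\<close>

lemma excess_c_bar:
  assumes "0 < \<eta>"
  shows "(1 - exp (- \<eta>)) * (c_bar \<eta> F - a) \<le> (\<integral>s. max 0 (s - a) \<partial>F)"
    and "(1 - exp (- \<eta>)) * (c_bar \<eta> F - the_inv_into {0..1} (cdf F) (exp (- \<eta>))) =
      (\<integral>s. max 0 (s - the_inv_into {0..1} (cdf F) (exp (- \<eta>))) \<partial>F)"
    and "c_bar \<eta> F \<le> 1"
proof -
  define q where "q = the_inv_into {0..1} (cdf F) (exp (- \<eta>))"
  note m = quantile(3)[OF assms, folded q_def] and cb = c_bar_eq[OF assms, folded q_def]
  have i: "integrable F (\<lambda>s. s * indicator {q..} s)"
    by (rule F.integrable_bounded[of _ 1]) (auto split: split_indicator)
  have eq: "(1 - exp (- \<eta>)) * (c_bar \<eta> F - a) = (\<integral>s. s * indicator {q..} s - a * indicator {q..} s \<partial>F)" for a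

  proof -
    have "(\<integral>s. s * indicator {q..} s - a * indicator {q..} s \<partial>F) = (\<integral>s. s * indicator {q..} s \<partial>F) - a * measure F {q..}"
      using i by simp
    then show ?thesis by (simp only: cb[symmetric] m right_diff_distrib mult.commute)
  qed
  show "(1 - exp (- \<eta>)) * (c_bar \<eta> F - a) \<le> (\<integral>s. max 0 (s - a) \<partial>F)"
    unfolding eq using i F.integrable_pos_part by (intro integral_mono) (auto split: split_indicator)
  show "(1 - exp (- \<eta>)) * (c_bar \<eta> F - the_inv_into {0..1} (cdf F) (exp (- \<eta>))) =
      (\<integral>s. max 0 (s - the_inv_into {0..1} (cdf F) (exp (- \<eta>))) \<partial>F)"
    unfolding q_def[symmetric] eq by (intro Bochner_Integration.integral_cong) (auto split: split_indicator)
  have "(\<integral>s. s * indicator {q..} s \<partial>F) \<le> (\<integral>s. 1 * indicator {q..} s \<partial>F)"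
  proof (rule integral_mono_AE)
    show "AE s in F. s * indicator {q..} s \<le> 1 * indicator {q..} s"
      using F.AE_unit by eventually_elim (auto split: split_indicator)
  qed (use i in auto)
  then have "(1 - exp (- \<eta>)) * c_bar \<eta> F \<le> (1 - exp (- \<eta>)) * 1" using m by (simp add: cb)
  then show "c_bar \<eta> F \<le> 1" using assms by simp
qed

text \<open>A supporting line for each regime: slope \<open>- 1\<close> from Jensen if
  \<open>c < \<mu>\<close>; the tangent of \<open>eF\<close> at 0 if \<open>\<eta> = 0\<close>;
  otherwise the line of \<open>excess_c_bar\<close>, made slightly steeper because
  \<open>\<alpha>\<close> must exceed the threshold strictly.\<close>

lemma ex_pos_val:
  assumes "c < c_bar \<eta> F"
  shows "\<exists>\<alpha> r. feasible \<alpha> r \<and> 0 < val \<alpha> r"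
proof -
  have c1: "c < 1" using assms excess_c_bar(3) eta_nonneg by (cases "0 < \<eta>") (auto simp: c_bar_def)
  have d1: "1 - exp (- \<eta>) < 1" by simp
  have one: "\<mu> - c \<le> 1 * x + eF x" for x
    using cdf_integral_nonneg[OF unit_F, of 0 "c + x"] by (simp add: eF_def)
  consider "c < \<mu>" | "\<mu> \<le> c" "\<eta> = 0" | "\<mu> \<le> c" "0 < \<eta>" using eta_nonneg by linarith
  then show ?thesis
  proof cases
    case 1
    show ?thesis by (rule ex_pos_val_if_line[OF d1 order_refl c1, of "\<mu> - c"]) (use 1 one in auto)
  next
    case 2
    let ?\<alpha> = "measure F {c<..}"
    have "0 < eF 0" using c_pos c1 by (intro eF_pos) auto
    moreover have "0 < ?\<alpha>" using c1 by (intro measure_open_pos[of _ 1]) auto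
    moreover have "eF 0 \<le> ?\<alpha> * x + eF x" if x: "x \<in> {- c..1 - c}" for x
    proof -
      have "eF 0 = (\<integral>s. max 0 (s - c) \<partial>F)" using eF_excess[of 0] c_pos c1 by simp
      also have "\<dots> \<le> (\<integral>s. max 0 (s - (c + x)) + x * indicator {c<..} s \<partial>F)"
        using F.integrable_pos_part by (intro integral_mono) (auto split: split_indicator)
      also have "\<dots> = eF x + x * ?\<alpha>"
        using F.integrable_pos_part by (simp add: eF_excess[OF x])
      finally show ?thesis by (simp add: mult.commute)
    qed
    ultimately show ?thesis using 2 c1 by (intro ex_pos_val_if_line[of ?\<alpha> "eF 0"]) auto
  next
    case 3
    define \<delta> where "\<delta> = 1 - exp (- \<eta>)"
    define A where "A = \<delta> * (c_bar \<eta> F - c)"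
    define D where "D = A + (c - \<mu>)"
    \<comment> \<open>The line of height \<open>A\<close> is mixed with weight \<open>k\<close> with
      the slope \<open>- 1\<close> line of height \<open>\<mu> - c\<close>. The mixture loses
      \<open>k * D\<close> in height, and this \<open>k\<close> makes the loss half of
      \<open>A\<close>.\<close>
    define k where "k = A / (2 * D)"
    have \<delta>: "0 < \<delta>" "\<delta> < 1" using 3 by (auto simp: \<delta>_def)
    have A: "0 < A" using \<delta> assms by (simp add: A_def)
    have D: "0 < D" "A \<le> D" using A 3 by (auto simp: D_def)
    have k: "0 < k" "k < 1" using A D by (auto simp: k_def divide_less_eq)
    have kA: "k * D = A / 2" using D by (simp add: k_def)
    define \<alpha> where "\<alpha> = (1 - k) * \<delta> + k"
    define M where "M = (1 - k) * A + k * (\<mu> - c)"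
    have "M = A - k * D" by (simp add: M_def D_def algebra_simps)
    then have M: "0 < M" using kA A by simp
    have "\<alpha> = \<delta> + k * (1 - \<delta>)" by (simp add: \<alpha>_def algebra_simps)
    then have a1: "\<delta> < \<alpha>" using k \<delta> by simp
    have "\<alpha> = 1 - (1 - k) * (1 - \<delta>)" by (simp add: \<alpha>_def algebra_simps)
    then have a2: "\<alpha> \<le> 1" using k \<delta> by simp
    show ?thesis
    proof (rule ex_pos_val_if_line[OF _ a2 c1 M])
      show "1 - exp (- \<eta>) < \<alpha>" using a1 by (simp add: \<delta>_def)
      show "\<mu> - c \<le> M" using M 3 by simp
      fix x assume x: "x \<in> {- c..1 - c}"
      have "A \<le> \<delta> * x + eF x"
        using excess_c_bar(1)[OF 3(2), of "c + x"] eF_excess[OF x] by (simp add: A_def \<delta>_def algebra_simps)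
      then have "(1 - k) * A + k * (\<mu> - c) \<le> (1 - k) * (\<delta> * x + eF x) + k * (1 * x + eF x)"
        using k one[of x] by (intro add_mono mult_left_mono) auto
      also have "\<dots> = \<alpha> * x + eF x" by (simp add: \<alpha>_def algebra_simps)
      finally show "M \<le> \<alpha> * x + eF x" by (simp add: M_def)
    qed
  qed
qed

text \<open>At \<open>x = q - c\<close>, where the supporting line touches,
  \<open>q \<le> c_bar \<eta> F \<le> c\<close> makes \<open>x\<close> nonpositive. Lowering its
  coefficient from \<open>\<alpha>\<close> to the threshold only increases the bound, which becomes
  \<open>(1 - exp (- \<eta>)) * (c_bar \<eta> F - c)\<close>.\<close>

lemma pos_val_imp:
  assumes "feasible \<alpha> r" "0 < val \<alpha> r"
  shows "c < c_bar \<eta> F"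
proof (rule ccontr)
  assume n: "\<not> ?thesis"
  note fp = feasible_pos_val[OF assms]
  have f: "\<alpha> \<le> 1" "0 \<le> r" using assms by (auto simp: feasible_def)
  have ap: "0 < \<alpha>" by (rule alpha_pos[OF fp(1)])
  have c1: "c < 1" using fp by simp
  have eta: "0 < \<eta>" using n c1 eta_nonneg by (auto simp: c_bar_def split: if_splits)
  define q where "q = the_inv_into {0..1} (cdf F) (exp (- \<eta>))"
  define \<delta> where "\<delta> = 1 - exp (- \<eta>)"
  note q = quantile[OF eta, folded q_def]
  have qe: "\<delta> * (c_bar \<eta> F - q) = (\<integral>s. max 0 (s - q) \<partial>F)"
    using excess_c_bar(2)[OF eta] by (simp add: q_def \<delta>_def)
  have "0 \<le> \<delta> * (c_bar \<eta> F - q)" unfolding qe by (rule Bochner_Integration.integral_nonneg) simp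
  then have qc: "q \<le> c_bar \<eta> F" using eta by (simp add: \<delta>_def zero_le_mult_iff)
  have x: "q - c \<in> {- c..1 - c}" using q by simp
  have "\<Gamma> c \<eta> F \<alpha> r \<le> obj \<alpha> r (q - c)" by (rule Gamma_le_obj[OF fp(1) f x])
  also have "\<dots> = \<alpha> * (q - c) + \<delta> * (c_bar \<eta> F - q)"
    using qc n f eF_excess[OF x] qe by (simp add: obj_def)
  also have "\<dots> \<le> \<delta> * (q - c) + \<delta> * (c_bar \<eta> F - q)"
    using fp(1) qc n by (auto simp: \<delta>_def intro!: mult_right_mono_neg)
  also have "\<dots> = \<delta> * (c_bar \<eta> F - c)" by (simp add: algebra_simps)
  also have "\<dots> \<le> 0" using n eta by (auto simp: \<delta>_def mult_le_0_iff)
  finally show False using assms(2) mult_nonneg_nonneg[OF less_imp_le[OF ap] f(2)] by (simp add: val_def)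
qed

end

subsection \<open>Optimal signals\<close>

text \<open>\<open>total\<close> fixes the truncation point: the trading signals have expected
  excess \<open>\<Gamma> c \<eta> F \<alpha> r\<close> over \<open>c\<close>.
  \<open>no_trade\<close> places the remaining mass so that the mean is
  \<open>\<mu>\<close>.\<close>

locale equal_revenue = market +
  fixes \<alpha> r B s0 :: real
  assumes al: "1 - exp (- \<eta>) < \<alpha>" "\<alpha> \<le> 1"
    and r: "0 < r" "r \<le> B" "B \<le> 1 - c" and s0: "0 \<le> s0" "s0 \<le> c"
    and total: "\<alpha> * (r + integral {r..B} (\<lambda>t. J \<alpha> (r / t))) = \<Gamma> c \<eta> F \<alpha> r"
    and no_trade: "(1 - \<alpha>) * (c - s0) = \<Gamma> c \<eta> F \<alpha> r - (\<mu> - c)"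
begin

abbreviation "f t \<equiv> J \<alpha> (r / t)"

text \<open>The law conditional on \<open>s > c\<close>. When \<open>r < B\<close> the continuous
  part lies between an atom of mass \<open>1 - f r\<close> at \<open>c + r\<close> and one of mass
  \<open>f B\<close> at \<open>c + B\<close>.\<close>

definition trade_cdf :: "real \<Rightarrow> real" where
  "trade_cdf s = (if s < c + r then 0 else if s < c + B then 1 - f (s - c) else 1)"

definition signal_cdf :: "real \<Rightarrow> real" where
  "signal_cdf s = (1 - \<alpha>) * (if s0 \<le> s then 1 else 0) + \<alpha> * trade_cdf s"

definition signal :: "real measure" where
  "signal = interval_measure signal_cdf"

lemma ap: "0 < \<alpha>" by (rule alpha_pos[OF al(1)])

lemma r_nonneg: "0 \<le> r" using r by simp

lemma f_bounds: "r \<le> t \<Longrightarrow> 0 \<le> f t" "r \<le> t \<Longrightarrow> f t \<le> 1"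
  using J_bounds[OF al(1) ratio_bounds[OF r_nonneg, of t]] ratio_bounds[OF r_nonneg, of t] by auto

lemma f_integrable: "r \<le> a \<Longrightarrow> f integrable_on {a..b}"
  by (rule J_integrable[OF al(1) r_nonneg])

lemma continuous_on_f_shift: "continuous_on {c + r..} (\<lambda>s. f (s - c))"
proof -
  have "continuous_on {c + r..} (I_inv (ereal (eta_adj \<eta> \<alpha>)) \<circ> (\<lambda>s. r / (s - c)))"
  proof (rule continuous_on_compose)
    show "continuous_on {c + r..} (\<lambda>s. r / (s - c))" using r by (auto intro!: continuous_intros)
    show "continuous_on ((\<lambda>s. r / (s - c)) ` {c + r..}) (I_inv (ereal (eta_adj \<eta> \<alpha>)))"
      by (rule continuous_on_subset[OF continuous_on_I_inv[OF eta_adj_nonneg[OF al(1)]]])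
        (use r in \<open>auto simp: divide_le_eq\<close>)
  qed
  then show ?thesis by (simp add: o_def J_def)
qed

lemma mono_trade_cdf: "mono trade_cdf"
proof (rule monoI)
  fix x y :: real assume "x \<le> y"
  then show "trade_cdf x \<le> trade_cdf y"
    using f_bounds[of "x - c"] f_bounds[of "y - c"] J_ratio_antimono[OF al(1) r_nonneg, of "x - c" "y - c"]
    by (auto simp: trade_cdf_def)
qed

lemma mono_signal_cdf: "x \<le> y \<Longrightarrow> signal_cdf x \<le> signal_cdf y"
  unfolding signal_cdf_def using monoD[OF mono_trade_cdf, of x y] ap al(2)
  by (intro add_mono mult_left_mono) auto

lemma trade_cdf_right: "(trade_cdf \<longlongrightarrow> trade_cdf a) (at_right a)"
proof -
  consider "a < c + r" | "c + r \<le> a" "a < c + B" | "c + r \<le> a" "c + B \<le> a" by linarith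
  then show ?thesis
  proof cases
    case 1
    then have "eventually (\<lambda>s. trade_cdf s = trade_cdf a) (at_right a)"
      unfolding eventually_at_right_field by (intro exI[of _ "c + r"]) (auto simp: trade_cdf_def)
    then show ?thesis by (rule tendsto_eventually)
  next
    case 2
    have "((\<lambda>s. f (s - c)) \<longlongrightarrow> f (a - c)) (at a within {c + r..})"
      using continuous_on_f_shift 2 by (simp add: continuous_on_def)
    then have "((\<lambda>s. f (s - c)) \<longlongrightarrow> f (a - c)) (at_right a)"
      by (rule tendsto_within_subset) (use 2 in auto)
    then have "((\<lambda>s. 1 - f (s - c)) \<longlongrightarrow> 1 - f (a - c)) (at_right a)" by (intro tendsto_intros)
    moreover have "eventually (\<lambda>s. 1 - f (s - c) = trade_cdf s) (at_right a)"
      unfolding eventually_at_right_field using 2 by (intro exI[of _ "c + B"]) (auto simp: trade_cdf_def)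
    ultimately have "(trade_cdf \<longlongrightarrow> 1 - f (a - c)) (at_right a)" by (rule Lim_transform_eventually)
    then show ?thesis using 2 by (simp add: trade_cdf_def)
  next
    case 3
    then have "eventually (\<lambda>s. trade_cdf s = trade_cdf a) (at_right a)"
      unfolding eventually_at_right_field by (intro exI[of _ "a + 1"]) (auto simp: trade_cdf_def)
    then show ?thesis by (rule tendsto_eventually)
  qed
qed

lemma real_distribution_signal: "real_distribution signal"
  and cdf_signal: "cdf signal = signal_cdf"
proof -
  have rc: "continuous (at_right a) signal_cdf" for a
  proof -
    have "eventually (\<lambda>s. (if s0 \<le> s then 1 else 0 :: real) = (if s0 \<le> a then 1 else 0)) (at_right a)"
      unfolding eventually_at_right_field
      by (intro exI[of _ "if s0 \<le> a then a + 1 else s0"]) auto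
    then have "((\<lambda>s. if s0 \<le> s then 1 else 0 :: real) \<longlongrightarrow> (if s0 \<le> a then 1 else 0)) (at_right a)"
      by (rule tendsto_eventually)
    then show ?thesis
      unfolding continuous_within signal_cdf_def by (intro tendsto_intros trade_cdf_right)
  qed
  have bot: "(signal_cdf \<longlongrightarrow> 0) at_bot"
  proof (rule tendsto_eventually)
    show "eventually (\<lambda>s. signal_cdf s = 0) at_bot"
      unfolding eventually_at_bot_linorder
      by (intro exI[of _ "-1"]) (use r s0 c_pos in \<open>auto simp: signal_cdf_def trade_cdf_def\<close>)
  qed
  have top: "(signal_cdf \<longlongrightarrow> 1) at_top"
  proof (rule tendsto_eventually)
    show "eventually (\<lambda>s. signal_cdf s = 1) at_top"
      unfolding eventually_at_top_linorder
      by (intro exI[of _ "c + B"]) (use r s0 c_pos in \<open>auto simp: signal_cdf_def trade_cdf_def\<close>)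
  qed
  show "real_distribution signal"
    unfolding signal_def by (rule real_distribution_interval_measure[OF mono_signal_cdf rc bot top])
  show "cdf signal = signal_cdf"
    unfolding signal_def by (rule cdf_interval_measure[OF mono_signal_cdf rc bot])
qed

text \<open>Buyers accept at \<open>s \<ge> p\<close>, so with atoms present it is the left limit of
  the CDF that determines demand.\<close>

lemma measure_below:
  assumes "(signal_cdf \<longlongrightarrow> L) (at_left p)"
  shows "measure signal {..<p} = L"
proof -
  interpret S: real_distribution signal by (rule real_distribution_signal)
  show ?thesis using tendsto_unique[OF _ assms] S.cdf_at_left[of p] by (simp add: cdf_signal)
qed

lemma measure_below_no_trade: "p \<le> s0 \<Longrightarrow> measure signal {..<p} = 0"
proof (rule measure_below, rule tendsto_eventually)
  assume "p \<le> s0"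
  then show "eventually (\<lambda>s. signal_cdf s = 0) (at_left p)"
    unfolding eventually_at_left_field using r s0
    by (intro exI[of _ "p - 1"]) (auto simp: signal_cdf_def trade_cdf_def)
qed

lemma measure_below_gap: "s0 < p \<Longrightarrow> p \<le> c + r \<Longrightarrow> measure signal {..<p} = 1 - \<alpha>"
proof (rule measure_below, rule tendsto_eventually)
  assume "s0 < p" "p \<le> c + r"
  then show "eventually (\<lambda>s. signal_cdf s = 1 - \<alpha>) (at_left p)"
    unfolding eventually_at_left_field
    by (intro exI[of _ s0]) (auto simp: signal_cdf_def trade_cdf_def)
qed

lemma measure_below_trade:
  assumes p: "c + r < p" "p \<le> c + B" shows "measure signal {..<p} = 1 - \<alpha> * f (p - c)"
proof (rule measure_below)
  have "continuous_on {c + r<..} (\<lambda>s. f (s - c))"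
    by (rule continuous_on_subset[OF continuous_on_f_shift]) auto
  then have "isCont (\<lambda>s. f (s - c)) p" using p by (simp add: continuous_on_eq_continuous_at)
  then have "((\<lambda>s. f (s - c)) \<longlongrightarrow> f (p - c)) (at p)" by (rule isContD)
  then have "((\<lambda>s. f (s - c)) \<longlongrightarrow> f (p - c)) (at_left p)"
    by (rule tendsto_within_subset) simp
  then have "((\<lambda>s. 1 - \<alpha> * f (s - c)) \<longlongrightarrow> 1 - \<alpha> * f (p - c)) (at_left p)" by (intro tendsto_intros)
  moreover have "eventually (\<lambda>s. 1 - \<alpha> * f (s - c) = signal_cdf s) (at_left p)"
    unfolding eventually_at_left_field using p r s0
    by (intro exI[of _ "c + r"]) (auto simp: signal_cdf_def trade_cdf_def algebra_simps)
  ultimately show "(signal_cdf \<longlongrightarrow> 1 - \<alpha> * f (p - c)) (at_left p)" by (rule Lim_transform_eventually)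
qed

lemma measure_below_top: "c + B < p \<Longrightarrow> measure signal {..<p} = 1"
proof (rule measure_below, rule tendsto_eventually)
  assume "c + B < p"
  then show "eventually (\<lambda>s. signal_cdf s = 1) (at_left p)"
    unfolding eventually_at_left_field using r s0
    by (intro exI[of _ "c + B"]) (auto simp: signal_cdf_def trade_cdf_def)
qed

lemma signal_cdf_top: "c + B \<le> s \<Longrightarrow> signal_cdf s = 1"
  using r s0 by (auto simp: signal_cdf_def trade_cdf_def)

lemma unit_dist_signal: "unit_dist signal"
proof -
  interpret S: real_distribution signal by (rule real_distribution_signal)
  have "measure signal {..1} = measure signal {..<0} + measure signal {0..1}"
    by (subst S.finite_measure_Union[symmetric]) (auto intro!: arg_cong[where f = "measure signal"])
  moreover have "measure signal {..1} = 1"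
    using signal_cdf_top[of 1] r c_le by (simp add: cdf_signal[symmetric] cdf_def)
  moreover have "measure signal {..<0} = 0" using s0 by (intro measure_below_no_trade) auto
  ultimately show ?thesis
    by (simp add: unit_dist_def unit_dist_axioms_def real_distribution_signal)
qed

sublocale S: unit_dist signal by (rule unit_dist_signal)

lemma unit_distribution_signal: "unit_distribution signal"
  by (simp add: unit_distribution_iff unit_dist_signal)

lemma measure_trade: "s0 < p \<Longrightarrow> p \<le> c + r \<Longrightarrow> measure signal {p..} = \<alpha>"
  by (simp add: S.measure_atLeast measure_below_gap)

lemma measure_tail: "c + r < p \<Longrightarrow> p \<le> c + B \<Longrightarrow> measure signal {p..} = \<alpha> * f (p - c)"
  by (simp add: S.measure_atLeast measure_below_trade)

lemma measure_above_top: "c + B < p \<Longrightarrow> measure signal {p..} = 0"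
  by (simp add: S.measure_atLeast measure_below_top)

lemma measure_above_cost: "measure signal {c<..} = \<alpha>"
  using r s0 by (simp add: S.measure_greaterThan cdf_signal signal_cdf_def trade_cdf_def)

lemma measure_no_trade: "measure signal {s0} = 1 - \<alpha>"
proof -
  have "measure signal {..s0} = measure signal {..<s0} + measure signal {s0}"
    by (subst S.finite_measure_Union[symmetric]) (auto intro!: arg_cong[where f = "measure signal"])
  moreover have "measure signal {..s0} = 1 - \<alpha>"
    using r s0 cdf_signal by (simp add: cdf_def fun_eq_iff signal_cdf_def trade_cdf_def)
  ultimately show ?thesis by (simp add: measure_below_no_trade)
qed

lemma measure_trade_interval: "measure signal {c + r..c + B} = \<alpha>"
proof -
  have "measure signal {..c + B} = measure signal {..<c + r} + measure signal {c + r..c + B}"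
    using r by (subst S.finite_measure_Union[symmetric]) (auto intro!: arg_cong[where f = "measure signal"])
  moreover have "measure signal {..c + B} = 1"
    using signal_cdf_top[of "c + B"] by (simp add: cdf_signal[symmetric] cdf_def)
  ultimately show ?thesis using measure_below_gap[of "c + r"] r s0 by simp
qed

lemma integral_trade_cdf:
  shows "z \<le> c + r \<Longrightarrow> integral {0..z} trade_cdf = 0"
    and "c + r \<le> z \<Longrightarrow> z \<le> c + B \<Longrightarrow> integral {0..z} trade_cdf = (z - c - r) - integral {r..z - c} f"
    and "c + B \<le> z \<Longrightarrow> integral {0..z} trade_cdf = (z - c - r) - integral {r..B} f"
proof -
  have int: "trade_cdf integrable_on {a..b}" for a b
    using mono_trade_cdf by (intro integrable_on_mono_on) (auto simp: mono_on_def mono_def)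
  show low: "integral {0..z} trade_cdf = 0" if "z \<le> c + r" for z
  proof -
    have "integral {0..z} trade_cdf = integral {0..z} (\<lambda>_. 0)"
      by (rule integral_spike[of "{c + r}"]) (use that in \<open>auto simp: trade_cdf_def\<close>)
    then show ?thesis by simp
  qed
  show mid: "integral {0..z} trade_cdf = (z - c - r) - integral {r..z - c} f" if z: "c + r \<le> z" "z \<le> c + B" for z
  proof -
    have "integral {0..z} trade_cdf = integral {0..c + r} trade_cdf + integral {c + r..z} trade_cdf"
      using z c_pos r int by (intro Henstock_Kurzweil_Integration.integral_combine[symmetric]) auto
    also have "integral {c + r..z} trade_cdf = integral {c + r..z} (\<lambda>s. 1 - f (s - c))"
      by (rule integral_spike[of "{c + B}"]) (use z in \<open>auto simp: trade_cdf_def\<close>)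
    also have "\<dots> = integral {r - - c..(z - c) - - c} (\<lambda>s. 1 - f (s + - c))" by (simp add: add.commute)
    also have "\<dots> = integral {r..z - c} (\<lambda>t. 1 - f t)" by (rule integral_shift_real_ivl)
    also have "\<dots> = (z - c - r) - integral {r..z - c} f"
      using z f_integrable[of r] by (subst Henstock_Kurzweil_Integration.integral_diff) auto
    finally show ?thesis using low[of "c + r"] by simp
  qed
  show "integral {0..z} trade_cdf = (z - c - r) - integral {r..B} f" if z: "c + B \<le> z"
  proof -
    have "integral {0..z} trade_cdf = integral {0..c + B} trade_cdf + integral {c + B..z} trade_cdf"
      using z c_pos r int by (intro Henstock_Kurzweil_Integration.integral_combine[symmetric]) auto
    also have "integral {c + B..z} trade_cdf = integral {c + B..z} (\<lambda>_. 1)"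
      using r by (intro Henstock_Kurzweil_Integration.integral_cong) (auto simp: trade_cdf_def)
    finally show ?thesis using mid[of "c + B"] z r by simp
  qed
qed

lemma integral_signal_cdf:
  assumes "0 \<le> z"
  shows "integral {0..z} signal_cdf = (1 - \<alpha>) * max 0 (z - s0) + \<alpha> * integral {0..z} trade_cdf"
proof -
  let ?i = "\<lambda>s. if s \<in> {s0..} then 1 else 0 :: real"
  have int: "trade_cdf integrable_on {0..z}"
    using mono_trade_cdf by (intro integrable_on_mono_on) (auto simp: mono_on_def mono_def)
  have eq: "{s0..} \<inter> {0..z} = {s0..z}" using s0 by auto
  have "?i integrable_on {0..z}" unfolding integrable_restrict_Int eq by (rule integrable_const_ivl)
  moreover have "integral {0..z} ?i = max 0 (z - s0)" unfolding integral_restrict_Int eq by (auto simp: max_def)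
  moreover have "signal_cdf = (\<lambda>s. (1 - \<alpha>) * ?i s + \<alpha> * trade_cdf s)"
    by (auto simp: signal_cdf_def)
  ultimately show ?thesis
    using int integrable_on_mult_right[of ?i "{0..z}" "1 - \<alpha>"] integrable_on_mult_right[OF int, of \<alpha>]
    by (simp add: Henstock_Kurzweil_Integration.integral_add)
qed

lemma mean_signal: "mean signal = \<mu>"
proof -
  have z: "integral {0..1} signal_cdf = (1 - \<alpha>) * (1 - s0) + \<alpha> * ((1 - c - r) - integral {r..B} f)"
    using integral_signal_cdf[of 1] integral_trade_cdf(3)[of 1] r s0 c_le by simp
  have "(\<integral>s. max 0 (s - 1) \<partial>signal) = (\<integral>s. 0 \<partial>signal)"
  proof (rule integral_cong_AE)
    show "AE s in signal. max 0 (s - 1) = 0" using S.AE_unit by eventually_elim auto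
  qed auto
  then have "mean signal = 1 - integral {0..1} signal_cdf"
    using S.excess_eq[of 1] by (simp add: cdf_signal)
  also have "\<dots> = 1 - ((1 - \<alpha>) * (c - s0) + (1 - c) - \<alpha> * (r + integral {r..B} f))"
    unfolding z by (simp add: algebra_simps)
  also have "\<dots> = \<mu>" unfolding total no_trade by simp
  finally show ?thesis .
qed

text \<open>Between \<open>s0\<close> and \<open>c + B\<close> the order constraint at
  \<open>c + x\<close> is the inequality \<open>\<Gamma> \<le> obj \<alpha> r x\<close> rearranged.
  Beyond \<open>c + B\<close> the signal has no excess left, and \<open>eF x \<ge> 0\<close>
  suffices.\<close>

lemma Bayes_plausible_signal: "Bayes_plausible F signal"
  unfolding Bayes_plausible_def
proof (intro conjI ballI)
  show "mean signal = mean F" by (simp add: mean_signal mean_F)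
  show "unit_distribution signal" by (rule unit_distribution_signal)
  fix z :: real assume z: "z \<in> {0..1}"
  define x where "x = z - c"
  have x: "x \<in> {- c..1 - c}" using z by (simp add: x_def)
  have zx: "z = c + x" by (simp add: x_def)
  have G: "\<Gamma> c \<eta> F \<alpha> r \<le> obj \<alpha> r x" by (rule Gamma_le_obj[OF al r_nonneg x])
  have \<Phi>: "integral {0..z} (cdf F) = eF x - (\<mu> - c - x)" by (simp add: eF_def zx)
  have I: "integral {0..z} (cdf signal) = (1 - \<alpha>) * max 0 (z - s0) + \<alpha> * integral {0..z} trade_cdf"
    using integral_signal_cdf z by (simp add: cdf_signal)
  have nt: "(1 - \<alpha>) * (z - s0) = \<Gamma> c \<eta> F \<alpha> r - (\<mu> - c) + (1 - \<alpha>) * x"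
    unfolding no_trade[symmetric] by (simp add: zx algebra_simps)
  consider "z \<le> s0" | "s0 < z" "x \<le> r" | "s0 < z" "r < x" "x \<le> B" | "s0 < z" "B < x" using r by linarith
  then show "integral {0..z} (cdf signal) \<le> integral {0..z} (cdf F)"
  proof cases
    case 1
    then have "integral {0..z} (cdf signal) = 0" unfolding I using integral_trade_cdf(1)[of z] s0 r by simp
    then show ?thesis using cdf_integral_nonneg[OF unit_F] by simp
  next
    case 2
    then have "integral {0..z} (cdf signal) = \<Gamma> c \<eta> F \<alpha> r - (\<mu> - c) + (1 - \<alpha>) * x"
      unfolding I using integral_trade_cdf(1)[of z] nt by (simp add: zx)
    then show ?thesis unfolding \<Phi> using G 2 by (simp add: obj_def algebra_simps)
  next
    case 3
    then have "integral {0..z} (cdf signal) = \<Gamma> c \<eta> F \<alpha> r - (\<mu> - c) + (1 - \<alpha>) * x + \<alpha> * (x - r - integral {r..x} f)"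
      unfolding I using integral_trade_cdf(2)[of z] nt by (simp add: zx)
    then show ?thesis unfolding \<Phi> using G 3 by (simp add: obj_def algebra_simps)
  next
    case 4
    then have "integral {0..z} (cdf signal) = \<Gamma> c \<eta> F \<alpha> r - (\<mu> - c) + (1 - \<alpha>) * x + \<alpha> * (x - r - integral {r..B} f)"
      unfolding I using integral_trade_cdf(3)[of z] nt by (simp add: zx)
    also have "\<dots> = \<Gamma> c \<eta> F \<alpha> r - (\<mu> - c) + x - \<alpha> * (r + integral {r..B} f)" by (simp add: algebra_simps)
    also have "\<dots> = x - (\<mu> - c)" unfolding total by simp
    finally show ?thesis unfolding \<Phi> using eF_nonneg[OF x] by simp
  qed
qed

lemma surplus_signal: "(\<integral>s. max 0 (s - (c + r)) \<partial>signal) = val \<alpha> r"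
proof -
  have "(\<integral>s. max 0 (s - (c + r)) \<partial>signal) = \<mu> - (c + r) + (1 - \<alpha>) * (c + r - s0)"
    using S.excess_eq[of "c + r"] integral_signal_cdf[of "c + r"] integral_trade_cdf(1)[of "c + r"] c_pos r s0
    by (simp add: mean_signal cdf_signal)
  also have "(1 - \<alpha>) * (c + r - s0) = (1 - \<alpha>) * (c - s0) + (1 - \<alpha>) * r" by (simp add: algebra_simps)
  finally show ?thesis unfolding no_trade by (simp add: val_def algebra_simps)
qed

section \<open>The price under every admissible belief\<close>

text \<open>Ignoring all trading signals would cost at least \<open>- ln (1 - \<alpha>)\<close>,
  more than \<open>\<eta>\<close>. Such a belief has to be excluded: every price would earn 0 and
  the least maximiser would be \<open>c\<close>.\<close>

lemma belief_above_cost_pos: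
  assumes H: "admissible \<eta> signal H"
  shows "0 < measure H {c<..}"
proof (rule ccontr)
  interpret H: unit_dist H using H by (simp add: admissible_def unit_distribution_iff)
  assume "\<not> ?thesis"
  then have H0: "measure H {c<..} = 0" by (simp add: zero_less_measure_iff)
  define d where "d = exp (- \<eta>) - 1 + \<alpha>"
  \<comment> \<open>\<open>Z\<close> is the exponential moment of the function that is 0 on
    \<open>s \<le> c\<close> and \<open>ln w\<close> above. This \<open>w\<close> puts it halfway
    between \<open>1 - \<alpha>\<close> and \<open>exp (- \<eta>)\<close>, which leaves room for a
    constant \<open>k > 0\<close>; a belief ignoring \<open>s > c\<close> would give
    \<open>g\<close> the mean \<open>k\<close>.\<close>
  define Z where "Z = 1 - \<alpha> + d / 2"
  define w where "w = d / (2 * \<alpha>)"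
  have d: "0 < d" using al by (simp add: d_def)
  have Zd: "Z = exp (- \<eta>) - d / 2" by (simp add: Z_def d_def field_simps)
  have Z: "0 < Z" "Z < exp (- \<eta>)" using d al Zd by (auto simp: Z_def)
  have w: "0 < w" "\<alpha> * w = d / 2" using d ap by (auto simp: w_def)
  define k where "k = - \<eta> - ln Z"
  have "ln Z < ln (exp (- \<eta>))" using Z by (subst ln_less_cancel_iff) auto
  then have k: "0 < k" by (simp add: k_def)
  define g where "g s = k + ln w * indicator {c<..} s" for s
  have eg: "exp (g s) = exp k + exp k * (w - 1) * indicator {c<..} s + 0 * indicator {} s" for s
    using w by (auto simp: g_def exp_add right_diff_distrib split: split_indicator)
  have "(\<integral>s. exp (g s) \<partial>signal) = exp k + exp k * (w - 1) * measure signal {c<..} + 0 * measure signal {}"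
    unfolding eg by (rule S.integral_two_indicators) auto
  also have "\<dots> = exp k * Z"
    by (simp add: measure_above_cost Z_def w(2)[symmetric] algebra_simps)
  also have "\<dots> = exp (- \<eta>)" using Z by (simp add: k_def exp_diff)
  finally have "(\<integral>s. g s \<partial>H) \<le> 0"
    by (intro admissible_integral_nonpos[OF unit_distribution_signal H, of _ "\<bar>k\<bar> + \<bar>ln w\<bar>"])
      (auto simp: g_def split: split_indicator)
  moreover have "(\<integral>s. g s \<partial>H) = k"
    using H.integral_two_indicators[of "{c<..}" "{}" k "ln w" 0] H0 by (simp add: g_def)
  ultimately show False using k by simp
qed

lemma belief_no_gap:
  assumes H: "admissible \<eta> signal H" and q: "c < q" "q \<le> c + r"
  shows "measure H {q..} = measure H {c<..}"
proof -
  interpret H: unit_dist H using H by (simp add: admissible_def unit_distribution_iff)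
  have "measure signal {c<..} = measure signal {c<..<q} + measure signal {q..}"
    using q by (subst S.finite_measure_Union[symmetric]) (auto intro!: arg_cong[where f = "measure signal"])
  then have "measure signal {c<..<q} = 0" using measure_trade[of q] measure_above_cost q s0 by simp
  then have "measure H {c<..<q} = 0" by (intro admissible_null[OF unit_distribution_signal H]) auto
  moreover have "measure H {c<..} = measure H {c<..<q} + measure H {q..}"
    using q by (subst H.finite_measure_Union[symmetric]) (auto intro!: arg_cong[where f = "measure H"])
  ultimately show ?thesis by simp
qed

text \<open>The tail \<open>f (p - c)\<close> is, by definition of \<open>I_inv\<close>, the one
  from which raising the conditional probability of \<open>{p..}\<close> to
  \<open>r / (p - c)\<close> exhausts the adjusted level.\<close>

lemma belief_tail:
  assumes H: "admissible \<eta> signal H" and p: "c + r < p"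
  shows "(p - c) * measure H {p..} \<le> r * measure H {c<..}"
proof (cases "c + B < p")
  case True
  then have "measure H {p..} = 0"
    by (intro admissible_null[OF unit_distribution_signal H]) (auto simp: measure_above_top)
  then show ?thesis using r by simp
next
  case False
  interpret H: unit_dist H using H by (simp add: admissible_def unit_distribution_iff)
  define t where "t = p - c"
  define x where "x = r / t"
  define y where "y = f t"
  have t: "r < t" "p \<le> c + B" using p False by (auto simp: t_def)
  have tail: "measure signal {p..} = \<alpha> * y" using measure_tail[OF p] t by (simp add: y_def t_def)
  have x: "0 < x" "x < 1" "x * t = r" using t r by (auto simp: x_def)
  have yI: "y = I_inv (ereal (eta_adj \<eta> \<alpha>)) x" by (simp add: y_def J_def x_def)
  show ?thesis
  proof (cases "\<eta> = 0")
    \<comment> \<open>Here \<open>y = x\<close>, so the multiplier \<open>L\<close> of the other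
      case would be 0.\<close>
    case True
    then have "H = signal" using admissible_0_imp_eq[OF unit_distribution_signal] H by simp
    moreover have "y = x" using True I_inv_zero_level[of x] x yI ap by (simp add: eta_adj_def)
    moreover have "t * x = r" using x by (simp add: mult.commute)
    ultimately show ?thesis
      using tail measure_above_cost by (simp add: t_def[symmetric] mult.left_commute)
  next
    case False
    then have eta: "0 < \<eta>" using eta_nonneg by simp
    have "(exp (- \<eta>) - 1 + \<alpha>) / \<alpha> < 1" using ap eta by (simp add: divide_less_eq)
    moreover have "0 < (exp (- \<eta>) - 1 + \<alpha>) / \<alpha>" using ap al by simp
    ultimately have ea: "0 < eta_adj \<eta> \<alpha>" unfolding eta_adj_def by simp
    have y: "0 < y" "y < x" "kl x y = eta_adj \<eta> \<alpha>"
      using I_inv_bounds[of x "eta_adj \<eta> \<alpha>"] I_inv_less_self[of x "eta_adj \<eta> \<alpha>"] x ea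
      unfolding yI by auto
    \<comment> \<open>the multiplier \<open>L / t\<close> makes \<open>exp g\<close> the optimal tilt, so that the entropy bound is tight\<close>
    define L where "L = ln x + ln (1 - y) - ln y - ln (1 - x)"
    have "ln y < ln x" "ln (1 - x) < ln (1 - y)" using x y by auto
    then have L: "0 < L" by (simp add: L_def)
    have eL: "exp L = x * (1 - y) / (y * (1 - x))"
      using x y by (simp add: L_def exp_add exp_diff)
    define \<theta> where "\<theta> = L / t"
    have \<theta>: "0 < \<theta>" "\<theta> * t = L" using L t r by (auto simp: \<theta>_def)
    have \<theta>r: "\<theta> * r = x * L" using \<theta>(2) x(3) by (metis mult.assoc mult.commute)
    define g where "g s = \<theta> * (t * indicator {p..} s - r * indicator {c<..} s)" for s
    have eg: "exp (g s) = (if s \<le> c then 1 else if s < p then exp (- (\<theta> * r)) else exp L * exp (- (\<theta> * r)))" for s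
      using p r \<theta> by (auto simp: g_def algebra_simps exp_add[symmetric] split: split_indicator)
    have "(\<integral>s. exp (g s) \<partial>signal) =
      1 * (1 - \<alpha>) + exp (- (\<theta> * r)) * (\<alpha> - \<alpha> * y) + exp L * exp (- (\<theta> * r)) * (\<alpha> * y)"
      unfolding eg
      by (subst three_level_integral[OF unit_dist_signal]) (use p r in \<open>simp_all add: measure_above_cost tail\<close>)
    also have "\<dots> = 1 - \<alpha> + \<alpha> * (exp (- (\<theta> * r)) * ((1 - y) + exp L * y))"
      by (simp add: algebra_simps)
    \<comment> \<open>With this multiplier the conditional exponential moment collapses to
      \<open>exp (- kl x y)\<close>; as \<open>kl x y\<close> is the adjusted level, the total is
      exactly \<open>exp (- \<eta>)\<close>.\<close>
    also have "(1 - y) + exp L * y = (1 - y) / (1 - x)"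
      unfolding eL using x y by (simp add: field_simps)
    also have "exp (- (\<theta> * r)) * ((1 - y) / (1 - x)) = exp (- (x * L) + ln (1 - y) - ln (1 - x))"
      unfolding \<theta>r using x y by (simp add: exp_add exp_diff exp_minus divide_inverse)
    also have "- (x * L) + ln (1 - y) - ln (1 - x) = - kl x y"
      by (simp add: L_def kl_def algebra_simps)
    also have "1 - \<alpha> + \<alpha> * exp (- kl x y) = exp (- \<eta>)" unfolding y(3) using exp_eta_adj[OF al(1)] by simp
    finally have "(\<integral>s. g s \<partial>H) \<le> 0"
      using \<theta> t r
      by (intro admissible_integral_nonpos[OF unit_distribution_signal H, of _ "\<theta> * t + \<theta> * r"])
        (auto simp: g_def abs_mult split: split_indicator intro!: mult_left_mono simp flip: distrib_left)
    moreover have "(\<integral>s. g s \<partial>H) = \<theta> * (t * measure H {p..} - r * measure H {c<..})"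
      using H.integral_two_indicators[of "{p..}" "{c<..}" 0 "\<theta> * t" "- \<theta> * r"]
      by (simp add: g_def algebra_simps)
    ultimately show ?thesis using \<theta>(1) by (simp add: mult_le_0_iff t_def)
  qed
qed

text \<open>Up to \<open>c + r\<close> demand is constant and positive, so profit rises strictly;
  higher prices can at best tie, and \<open>LEAST\<close> resolves ties downwards.\<close>

lemma price_signal:
  assumes H: "admissible \<eta> signal H"
  shows "seller_price c H = c + r"
proof -
  interpret H: unit_dist H using H by (simp add: admissible_def unit_distribution_iff)
  define \<beta> where "\<beta> = measure H {c<..}"
  have \<beta>: "0 < \<beta>" unfolding \<beta>_def by (rule belief_above_cost_pos[OF H])
  have at_r: "measure H {c + r..} = \<beta>" using belief_no_gap[OF H, of "c + r"] r by (simp add: \<beta>_def)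
  have cr: "c + r \<in> {c..1}" using r by simp
  have "seller_price c H \<le> c + r"
  proof (rule H.seller_price_least[OF _ c_le cr])
    fix p assume p: "p \<in> {c..1}"
    consider "p = c" | "c < p" "p \<le> c + r" | "c + r < p" using p by force
    then show "(p - c) * measure H {p..} \<le> (c + r - c) * measure H {c + r..}"
    proof cases
      case 2
      then show ?thesis using belief_no_gap[OF H, of p] \<beta> by (simp add: at_r \<beta>_def)
    next
      case 3
      then show ?thesis using belief_tail[OF H] by (simp add: at_r \<beta>_def)
    qed (use r \<beta> at_r in simp)
  qed (use c_pos in simp)
  moreover have "\<not> seller_price c H < c + r"
  proof
    assume lt: "seller_price c H < c + r"
    have mem: "seller_price c H \<in> {c..1}" using H.seller_price_mem c_pos c_le by simp
    have le: "r * \<beta> \<le> (seller_price c H - c) * measure H {seller_price c H..}"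
      using H.seller_price_max[OF _ c_le cr] c_pos at_r by simp
    show False
    proof (cases "seller_price c H = c")
      case True
      then show ?thesis using le r \<beta> by (simp add: mult_le_0_iff)
    next
      case False
      then have "measure H {seller_price c H..} = \<beta>"
        using belief_no_gap[OF H, of "seller_price c H"] mem lt by (simp add: \<beta>_def)
      then show ?thesis using le lt \<beta> by simp
    qed
  qed
  ultimately show ?thesis by simp
qed

lemma robust_surplus_signal: "robust_surplus c \<eta> signal = val \<alpha> r"
proof -
  have "(\<lambda>H. LINT s:{seller_price c H..1}|signal. s - seller_price c H) ` {H. admissible \<eta> signal H} = {val \<alpha> r}"
    using admissible_self[OF unit_distribution_signal eta_nonneg]
    by (auto simp: price_signal S.surplus_eq surplus_signal image_iff)
  then show ?thesis by (simp add: robust_surplus_def)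
qed

end

text \<open>\<open>\<alpha> * r \<le> \<Gamma>\<close> and the bound at \<open>x = 1 - c\<close>
  bracket the truncation point. \<open>\<mu> - c \<le> \<Gamma>\<close> and the bound at
  \<open>x = - c\<close> place \<open>s0\<close> between 0 and \<open>c\<close>.\<close>

lemma (in market) ex_equal_revenue:
  assumes "feasible \<alpha> r" "0 < val \<alpha> r"
  shows "\<exists>B s0. equal_revenue c \<eta> \<mu> F \<alpha> r B s0"
proof -
  note fp = feasible_pos_val[OF assms]
  have f: "\<alpha> \<le> 1" "\<mu> - c \<le> \<Gamma> c \<eta> F \<alpha> r" "\<alpha> * r \<le> \<Gamma> c \<eta> F \<alpha> r"
    using assms by (auto simp: feasible_def)
  have r0: "0 \<le> r" using fp by simp
  let ?f = "\<lambda>t. J \<alpha> (r / t)"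
  have "\<exists>B\<ge>r. B \<le> 1 - c \<and> \<alpha> * (r + integral {r..B} ?f) = \<Gamma> c \<eta> F \<alpha> r"
  proof (rule IVT')
    show "\<alpha> * (r + integral {r..r} ?f) \<le> \<Gamma> c \<eta> F \<alpha> r" using f by simp
    show "\<Gamma> c \<eta> F \<alpha> r \<le> \<alpha> * (r + integral {r..1 - c} ?f)"
      using fp(6) by (simp add: val_def algebra_simps)
    show "continuous_on {r..1 - c} (\<lambda>B. \<alpha> * (r + integral {r..B} ?f))"
      using J_integrable[OF fp(1) r0] by (intro continuous_intros indefinite_integral_continuous_1) auto
  qed (use fp in auto)
  then obtain B where B: "r \<le> B" "B \<le> 1 - c" "\<alpha> * (r + integral {r..B} ?f) = \<Gamma> c \<eta> F \<alpha> r" by blast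
  have "\<Gamma> c \<eta> F \<alpha> r \<le> obj \<alpha> r (- c)"
    using r0 f c_pos c_le by (intro Gamma_le_obj[OF fp(1)]) auto
  then have up: "\<Gamma> c \<eta> F \<alpha> r \<le> \<mu> - \<alpha> * c" using r0 c_pos by (simp add: obj_def eF_def)
  \<comment> \<open>For \<open>\<alpha> = 1\<close> division by 0 makes \<open>s0 = c\<close>, and
    the equation holds because \<open>\<Gamma>\<close> is then squeezed to
    \<open>\<mu> - c\<close>.\<close>
  define s0 where "s0 = c - (\<Gamma> c \<eta> F \<alpha> r - (\<mu> - c)) / (1 - \<alpha>)"
  have s0: "0 \<le> s0 \<and> s0 \<le> c \<and> (1 - \<alpha>) * (c - s0) = \<Gamma> c \<eta> F \<alpha> r - (\<mu> - c)"
  proof (cases "\<alpha> = 1")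
    case True
    then show ?thesis using up f c_pos by (simp add: s0_def)
  next
    case False
    then have a: "0 < 1 - \<alpha>" using f by simp
    have "(\<Gamma> c \<eta> F \<alpha> r - (\<mu> - c)) / (1 - \<alpha>) \<le> c"
      using a up by (simp add: divide_le_eq algebra_simps)
    then show ?thesis using a f by (simp add: s0_def)
  qed
  have "equal_revenue c \<eta> \<mu> F \<alpha> r B s0"
    using fp f B s0 by unfold_locales auto
  then show ?thesis by blast
qed

text \<open>The complement of the support is a union of open null sets, and by Lindelof countably
  many of them cover it.\<close>

lemma unit_dist_of_support:
  assumes M: "real_distribution M" and supp: "dist_support M = {0..1}"
  shows "unit_dist M"
proof -
  interpret real_distribution M by (rule M)
  define \<U> where "\<U> = {U. open U \<and> measure M U = 0}"
  obtain \<V> where V: "\<V> \<subseteq> \<U>" "countable \<V>" "\<Union>\<V> = \<Union>\<U>"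
    using Lindelof[of \<U>] by (auto simp: \<U>_def)
  have null: "\<Union>\<V> \<in> null_sets M"
    using V by (intro null_sets_UN'[of \<V> "\<lambda>U. U", simplified]) (auto simp: \<U>_def emeasure_eq_measure null_sets_def)
  have sub: "- {0..1} \<subseteq> \<Union>\<V>"
  proof
    fix x :: real assume "x \<in> - {0..1}"
    then have "x \<notin> dist_support M" using supp by simp
    then show "x \<in> \<Union>\<V>" unfolding V(3) \<U>_def dist_support_def by (auto simp: zero_less_measure_iff)
  qed
  have "measure M (- {0..1}) \<le> measure M (\<Union>\<V>)"
    using null sub by (intro finite_measure_mono) auto
  then have "measure M (- {0..1}) = 0"
    using null by (simp add: null_sets_def emeasure_eq_measure measure_le_0_iff)
  then have "measure M {0..1} = 1" using prob_compl[of "{0..1}"] by (simp add: Compl_eq_Diff_UNIV)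
  then show ?thesis using M by (simp add: unit_dist_def unit_dist_axioms_def)
qed

theorem mainTheorem2:
  fixes c \<eta> \<mu> :: real and F :: "real measure"
  assumes "0 < c" and "c \<le> 1" and "0 \<le> \<eta>"
    and "real_distribution F" and "continuous_on UNIV (cdf F)"
    and "dist_support F = {0..1}" and "mean F = \<mu>"
  shows "(0 < max_robust_surplus c \<eta> F \<longleftrightarrow> c < c_bar \<eta> F) \<and>
    (c < c_bar \<eta> F \<longrightarrow>
      (\<exists>G \<alpha> r B s0.
        buyer_optimal c \<eta> F G \<and>
        \<alpha> = \<P>(s in G. c < s) \<and>
        (\<forall>H. admissible \<eta> G H \<longrightarrow>
          (seller_price c H - c) * \<P>(s in G. seller_price c H \<le> s \<bar> c < s) = r) \<and>
        is_arg_max (\<lambda>(\<alpha>, r). \<Gamma> c \<eta> F \<alpha> r - \<alpha> * r)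
          (\<lambda>(\<alpha>, r). \<alpha> \<in> {0..1} \<and> 0 \<le> r \<and> \<Gamma> c \<eta> F \<alpha> r \<ge> max (\<mu> - c) (\<alpha> * r)) (\<alpha>, r) \<and>
        0 \<le> s0 \<and> s0 \<le> c \<and> \<P>(s in G. s = s0) = 1 - \<alpha> \<and>
        r \<le> B \<and> \<P>(s in G. s \<in> {c + r..c + B} \<bar> c < s) = 1 \<and>
        (\<forall>p. c + r < p \<and> p \<le> c + B \<longrightarrow>
          \<P>(s in G. p \<le> s \<bar> c < s) = I_inv (\<eta>_star \<eta> \<alpha>) (r / (p - c)))))"
proof -
  have "regular_market c \<eta> \<mu> F"
    using assms unit_dist_of_support[of F]
    by (simp add: regular_market_def regular_market_axioms_def market_def)
  then interpret regular_market c \<eta> \<mu> F .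
  have F_plausible: "Bayes_plausible F F"
    by (simp add: Bayes_plausible_def unit_distribution_iff unit_F)
  show ?thesis
  proof (cases "c < c_bar \<eta> F")
    case False
    have "robust_surplus c \<eta> G \<le> 0" if "Bayes_plausible F G" for G
      using robust_surplus_le_val[OF that] pos_val_imp False by force
    then have "max_robust_surplus c \<eta> F \<le> 0"
      unfolding max_robust_surplus_def using F_plausible by (intro cSUP_least) auto
    then show ?thesis using False by auto
  next
    case True
    obtain \<alpha> r where ar: "feasible \<alpha> r" "0 < val \<alpha> r" "\<And>\<alpha>' r'. feasible \<alpha>' r' \<Longrightarrow> val \<alpha>' r' \<le> val \<alpha> r"
      using ex_pos_val[OF True] val_attained by blast
    obtain B s0 where "equal_revenue c \<eta> \<mu> F \<alpha> r B s0" using ex_equal_revenue[OF ar(1,2)] by blast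
    then interpret R: equal_revenue c \<eta> \<mu> F \<alpha> r B s0 .
    let ?G = "R.signal"
    have "robust_surplus c \<eta> G \<le> val \<alpha> r" if "Bayes_plausible F G" for G
      using robust_surplus_le_val[OF that] ar(2,3) by force
    then have max: "max_robust_surplus c \<eta> F = val \<alpha> r"
      unfolding max_robust_surplus_def using R.Bayes_plausible_signal R.robust_surplus_signal
      by (intro cSup_eq_maximum) (auto simp: image_iff intro: exI[of _ ?G])
    have opt: "buyer_optimal c \<eta> F ?G"
      by (simp add: buyer_optimal_def R.Bayes_plausible_signal R.robust_surplus_signal max)
    have Pc: "\<P>(s in ?G. c < s) = \<alpha>"
      using R.measure_above_cost by (simp add: greaterThan_def)
    have cond: "\<P>(s in ?G. p \<le> s \<bar> c < s) = measure ?G {p..} / \<alpha>" if "c < p" for p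
    proof -
      have "{s. p \<le> s \<and> c < s} = {p..}" using that by auto
      then show ?thesis using Pc by (simp add: cond_prob_def)
    qed
    have price: "(seller_price c H - c) * \<P>(s in ?G. seller_price c H \<le> s \<bar> c < s) = r"
      if "admissible \<eta> ?G H" for H
      using R.price_signal[OF that] R.r R.s0 R.ap R.measure_trade[of "c + r"] by (simp add: cond)
    have argmax: "is_arg_max (\<lambda>(\<alpha>, r). \<Gamma> c \<eta> F \<alpha> r - \<alpha> * r)
          (\<lambda>(\<alpha>, r). \<alpha> \<in> {0..1} \<and> 0 \<le> r \<and> \<Gamma> c \<eta> F \<alpha> r \<ge> max (\<mu> - c) (\<alpha> * r)) (\<alpha>, r)"
      using ar(1,3) unfolding is_arg_max_def feasible_def val_def by (auto simp: not_less)
    have atom: "\<P>(s in ?G. s = s0) = 1 - \<alpha>"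
      using R.measure_no_trade by simp
    have "{s. s \<in> {c + r..c + B} \<and> c < s} = {c + r..c + B}" using R.r by auto
    then have supp: "\<P>(s in ?G. s \<in> {c + r..c + B} \<bar> c < s) = 1"
      using Pc R.measure_trade_interval R.ap by (simp add: cond_prob_def)
    have tail: "\<P>(s in ?G. p \<le> s \<bar> c < s) = I_inv (\<eta>_star \<eta> \<alpha>) (r / (p - c))"
      if "c + r < p" "p \<le> c + B" for p
      using that R.measure_tail[OF that] R.r R.ap
      by (simp add: cond J_def eta_star_eq[OF R.al(1)])
    show ?thesis
      using True max ar(2) opt Pc price argmax R.s0 atom R.r supp tail
      by (intro conjI impI exI[of _ ?G] exI[of _ \<alpha>] exI[of _ r] exI[of _ B] exI[of _ s0]) auto
  qed
qed

end
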